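(* Let $G=(V,E)$ be a finite graph with maximum degree $\Delta\in\mathbb{Z}_+$, and let $(V_1,V_2,\dots,V_d)$ be any partition of $V$ satisfying $|V_1|\le|V_2|\le\dots\le|V_d|$. Let $$\eta:=\max_{t\in[d]}\left(\frac{\sum_{j=1}^t|V_j|}{|V_t|}\right),$$ and let $k\in\mathbb{Z}_+$ be any integer with $k\ge(4\eta+2)\Delta$. Then $G$ admits a $k$-coloring $(C_1,\dots,C_k)$ such that $|C_i\cap V_j|\in\left\{\left\lfloor\frac{|V_j|}{k}\right\rfloor,\left\lceil\frac{|V_j|}{k}\right\rceil\right\}$ for all $i\in[k]$ and $j\in[d]$. Furthermore, such a coloring can be computed in polynomial time.
   Context: A $k$-coloring of $G$ is a partition $(C_1,\dots,C_k)$ of $V$ into $k$ (possibly empty) sets, each of which is an independent set of $G$. *)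

theory Defs
  imports Complex_Main "HOL-Library.Disjoint_Sets" "HOL-Library.Log_Nat"
    "HOL-Computational_Algebra.Polynomial"
begin

section \<open>Graphs, partitions and colourings\<close>

definition finite_graph :: "'a set \<Rightarrow> 'a set set \<Rightarrow> bool" where
  "finite_graph V E \<longleftrightarrow> finite V \<and> (\<forall>e\<in>E. e \<subseteq> V \<and> card e = 2)"

definition vertex_degree :: "'a set set \<Rightarrow> 'a \<Rightarrow> nat" where
  "vertex_degree E v = card {e \<in> E. v \<in> e}"

definition max_degree :: "'a set \<Rightarrow> 'a set set \<Rightarrow> nat" where
  "max_degree V E = Max (vertex_degree E ` V)"

definition independent_set :: "'a set \<Rightarrow> 'a set set \<Rightarrow> 'a set \<Rightarrow> bool" where
  "independent_set V E S \<longleftrightarrow> S \<subseteq> V \<and> (\<forall>e\<in>E. \<not> e \<subseteq> S)"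

definition ordered_partition :: "'a set \<Rightarrow> nat \<Rightarrow> (nat \<Rightarrow> 'a set) \<Rightarrow> bool" where
  "ordered_partition V d Vs \<longleftrightarrow> (\<Union>j\<in>{1..d}. Vs j) = V \<and> disjoint_family_on Vs {1..d}"

definition k_coloring :: "'a set \<Rightarrow> 'a set set \<Rightarrow> nat \<Rightarrow> (nat \<Rightarrow> 'a set) \<Rightarrow> bool" where
  "k_coloring V E k C \<longleftrightarrow>
     ordered_partition V k C \<and> (\<forall>i\<in>{1..k}. independent_set V E (C i))"

definition eta :: "nat \<Rightarrow> (nat \<Rightarrow> 'a set) \<Rightarrow> real" where
  "eta d Vs = Max ((\<lambda>t. real (\<Sum>j=1..t. card (Vs j)) / real (card (Vs t))) ` {1..d})"

text \<open>The parts of the given partition are nonempty (otherwise \<open>eta\<close> would involve a quotient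
  with denominator zero), whereas \<^const>\<open>ordered_partition\<close> permits empty colour classes.\<close>

definition admissible ::
  "'a set \<Rightarrow> 'a set set \<Rightarrow> nat \<Rightarrow> nat \<Rightarrow> (nat \<Rightarrow> 'a set) \<Rightarrow> nat \<Rightarrow> bool" where
  "admissible V E \<Delta> d Vs k \<longleftrightarrow>
     finite_graph V E \<and> max_degree V E = \<Delta> \<and> 0 < \<Delta> \<and>
     1 \<le> d \<and> ordered_partition V d Vs \<and> (\<forall>j\<in>{1..d}. Vs j \<noteq> {}) \<and>
     (\<forall>i\<in>{1..d}. \<forall>j\<in>{1..d}. i \<le> j \<longrightarrow> card (Vs i) \<le> card (Vs j)) \<and>
     0 < k \<and> real k \<ge> (4 * eta d Vs + 2) * real \<Delta>"

definition balanced :: "nat \<Rightarrow> (nat \<Rightarrow> 'a set) \<Rightarrow> nat \<Rightarrow> (nat \<Rightarrow> 'a set) \<Rightarrow> bool" where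
  "balanced d Vs k C \<longleftrightarrow>
     (\<forall>i\<in>{1..k}. \<forall>j\<in>{1..d}.
        int (card (C i \<inter> Vs j)) \<in>
          {\<lfloor>real (card (Vs j)) / real k\<rfloor>, \<lceil>real (card (Vs j)) / real k\<rceil>})"


section \<open>A model of computation\<close>

text \<open>
  A first-order, call-by-value functional language over natural numbers and pairs. A program is a
  list of bodies of mutually recursive unary functions; variables are de Bruijn indices into the
  environment. Every evaluation step costs one unit. The only arithmetic is addition, truncated
  subtraction and comparison (no multiplication), so in \<open>t\<close> steps numbers grow by at most \<open>t\<close>
  bits beyond those of the input and the program text. As for random access machines with unit-cost
  addition and subtraction (Cook and Reckhow, 1973), and with pairs held as pointers, polynomial
  time in this model therefore coincides with polynomial time on Turing machines.
\<close>

datatype val = VNum nat | VPair val val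

datatype expr =
    Var nat
  | Const nat
  | Add expr expr
  | Sub expr expr
  | MkPair expr expr
  | Fst expr
  | Snd expr
  | IfLess expr expr expr expr
  | IfPair expr expr expr
  | LetIn expr expr
  | Call nat expr

inductive eval :: "expr list \<Rightarrow> val list \<Rightarrow> expr \<Rightarrow> val \<Rightarrow> nat \<Rightarrow> bool" for P where
  Var: "i < length env \<Longrightarrow> eval P env (Var i) (env ! i) 1"
| Const: "eval P env (Const n) (VNum n) 1"
| Add: "eval P env a (VNum m) s \<Longrightarrow> eval P env b (VNum n) t \<Longrightarrow>
    eval P env (Add a b) (VNum (m + n)) (s + t + 1)"
| Sub: "eval P env a (VNum m) s \<Longrightarrow> eval P env b (VNum n) t \<Longrightarrow>
    eval P env (Sub a b) (VNum (m - n)) (s + t + 1)"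
| MkPair: "eval P env a x s \<Longrightarrow> eval P env b y t \<Longrightarrow>
    eval P env (MkPair a b) (VPair x y) (s + t + 1)"
| Fst: "eval P env a (VPair x y) s \<Longrightarrow> eval P env (Fst a) x (s + 1)"
| Snd: "eval P env a (VPair x y) s \<Longrightarrow> eval P env (Snd a) y (s + 1)"
| IfLess: "eval P env a (VNum m) s \<Longrightarrow> eval P env b (VNum n) t \<Longrightarrow>
    eval P env (if m < n then c else d) z u \<Longrightarrow>
    eval P env (IfLess a b c d) z (s + t + u + 1)"
| IfPair: "eval P env a x s \<Longrightarrow>
    eval P env (case x of VPair _ _ \<Rightarrow> b | VNum _ \<Rightarrow> c) z t \<Longrightarrow>
    eval P env (IfPair a b c) z (s + t + 1)"
| LetIn: "eval P env a x s \<Longrightarrow> eval P (x # env) b z t \<Longrightarrow>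
    eval P env (LetIn a b) z (s + t + 1)"
| Call: "eval P env a x s \<Longrightarrow> f < length P \<Longrightarrow> eval P [x] (P ! f) z t \<Longrightarrow>
    eval P env (Call f a) z (s + t + 1)"

inductive_cases eval_elims:
  "eval P env (Var i) z t" "eval P env (Const n) z t" "eval P env (Add a b) z t"
  "eval P env (Sub a b) z t" "eval P env (MkPair a b) z t" "eval P env (Fst a) z t"
  "eval P env (Snd a) z t" "eval P env (IfLess a b c d) z t" "eval P env (IfPair a b c) z t"
  "eval P env (LetIn a b) z t" "eval P env (Call f a) z t"

lemma eval_deterministic:
  "eval P env e x s \<Longrightarrow> eval P env e y t \<Longrightarrow> x = y \<and> s = t"
proof (induction arbitrary: y t rule: eval.induct)
  case Var then show ?case by (auto elim: eval_elims)
next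
  case Const then show ?case by (auto elim: eval_elims)
next
  case Add show ?case by (rule eval_elims(3)[OF Add.prems]) (fastforce dest: Add.IH)
next
  case Sub show ?case by (rule eval_elims(4)[OF Sub.prems]) (fastforce dest: Sub.IH)
next
  case MkPair show ?case by (rule eval_elims(5)[OF MkPair.prems]) (fastforce dest: MkPair.IH)
next
  case Fst show ?case by (rule eval_elims(6)[OF Fst.prems]) (fastforce dest: Fst.IH)
next
  case Snd show ?case by (rule eval_elims(7)[OF Snd.prems]) (fastforce dest: Snd.IH)
next
  case IfLess show ?case by (rule eval_elims(8)[OF IfLess.prems]) (fastforce dest: IfLess.IH)
next
  case IfPair show ?case by (rule eval_elims(9)[OF IfPair.prems]) (fastforce dest: IfPair.IH)
next
  case LetIn show ?case by (rule eval_elims(10)[OF LetIn.prems]) (fastforce dest: LetIn.IH)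
next
  case Call show ?case by (rule eval_elims(11)[OF Call.prems]) (fastforce dest: Call.IH)
qed

definition runs :: "expr list \<Rightarrow> val \<Rightarrow> val \<Rightarrow> nat \<Rightarrow> bool" where
  "runs P x y t \<longleftrightarrow> eval P [x] (Call 0 (Var 0)) y t"

text \<open>Numbers contribute their number of binary digits (\<^term>\<open>floorlog 2 n\<close>) to the size.\<close>

fun vsize :: "val \<Rightarrow> nat" where
  "vsize (VNum n) = floorlog 2 n + 1"
| "vsize (VPair x y) = vsize x + vsize y + 1"


section \<open>Encoding of inputs and outputs\<close>

fun enc_list :: "('b \<Rightarrow> val) \<Rightarrow> 'b list \<Rightarrow> val" where
  "enc_list f [] = VNum 0"
| "enc_list f (x # xs) = VPair (f x) (enc_list f xs)"

definition enc_nat_pair :: "nat \<times> nat \<Rightarrow> val" where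
  "enc_nat_pair p = VPair (VNum (fst p)) (VNum (snd p))"

text \<open>The input consists of a list of the vertices, a list of the edges (in any order and
  orientation), the list of the parts, each given as a list of vertices, and \<open>k\<close> in binary.\<close>

definition encodes_instance ::
  "val \<Rightarrow> nat set \<Rightarrow> nat set set \<Rightarrow> nat \<Rightarrow> (nat \<Rightarrow> nat set) \<Rightarrow> nat \<Rightarrow> bool" where
  "encodes_instance x V E d Vs k \<longleftrightarrow>
     (\<exists>vs es ps.
        distinct vs \<and> set vs = V \<and>
        {{u, v} | u v. (u, v) \<in> set es} = E \<and>
        length ps = d \<and>
        (\<forall>j\<in>{1..d}. distinct (ps ! (j - 1)) \<and> set (ps ! (j - 1)) = Vs j) \<and>
        x = VPair (enc_list VNum vs)
             (VPair (enc_list enc_nat_pair es)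
               (VPair (enc_list (enc_list VNum) ps) (VNum k))))"

text \<open>Since \<open>k\<close> may be exponential in the input size, the colour classes are not listed one by one;
  the output lists each vertex exactly once together with the index of its class.\<close>

definition encodes_coloring :: "val \<Rightarrow> nat set \<Rightarrow> nat \<Rightarrow> (nat \<Rightarrow> nat set) \<Rightarrow> bool" where
  "encodes_coloring y V k C \<longleftrightarrow>
     (\<exists>cs. distinct (map fst cs) \<and> set (map fst cs) = V \<and>
        (\<forall>i\<in>{1..k}. C i = {v. (v, i) \<in> set cs}) \<and>
        y = enc_list enc_nat_pair cs)"

end

theory Submission
  imports Defs "HOL-Combinatorics.Transposition"
begin

text \<open>
  Start from a balanced colouring and remove clashes by exchanging the colours of two vertices of
  the same part, which preserves balance. If \<open>v \<in> V\<^sub>t\<close> has a neighbour of its own colour, then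
  \<open>u \<in> V\<^sub>t\<close> is a bad partner only if \<open>u\<close> shares its colour with a neighbour of \<open>v\<close> or has itself a
  neighbour of the colour of \<open>v\<close>. Working in \<open>V\<^sub>1 \<union> \<dots> \<union> V\<^sub>t\<close>, there are few such \<open>u\<close> as long
  as the colour classes there have size \<open>O(|V\<^sub>1 \<union> \<dots> \<union> V\<^sub>t| / k)\<close>. Many small parts could spoil this,
  so consecutive parts are first merged into groups as long as a group has at most \<open>k\<close> vertices
  (within such a group all colours are kept distinct), and groups with fewer than \<open>k\<close> vertices are
  filled up with isolated dummy vertices. If \<open>k \<ge> |V|\<close>, all vertices get different colours; otherwise
  \<open>k\<close> is polynomial in the input size, and so is the running time.
\<close>

section \<open>Bounded-time evaluation\<close>

text \<open>The bound on \<open>k\<close> is spent on a single inequality. Take a group of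
  \<open>w \<ge> k\<close> vertices, dummies included, and let \<open>M\<close> count the original
  vertices up to its end. Padding to \<open>k\<close> vertices makes rounding up cost at most a
  factor 2: \<open>k * ceil_div w k < w + k \<le> 2 * w\<close>. The classes on all vertices
  coloured so far, this group included, satisfy
  \<open>k * N \<le> 2 * M + k \<le> 2 * M + w\<close>. Fewer than \<open>w\<close> partners are
  therefore bad once \<open>\<Delta> * (2 * M + 3 * w) < k * w\<close>. The summand
  \<open>4 * \<eta>\<close>, applied to the last part of the group, bounds
  \<open>2 * \<Delta> * M\<close> by half of \<open>k * w\<close>; the summand 2 lowers this by a
  further \<open>\<Delta> * w\<close>. What is left to show is \<open>4 * \<Delta> < k\<close>, and
  \<open>6 * \<Delta> \<le> k\<close> holds since the quotient for \<open>t = 1\<close> is 1. The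
  increasing order of the parts matters because only the prefix enters \<open>M\<close>: while a
  group is repaired, later vertices are still uncoloured, and later swaps stay inside their own
  group.\<close>

definition evb :: "expr list \<Rightarrow> val list \<Rightarrow> expr \<Rightarrow> val \<Rightarrow> nat \<Rightarrow> bool" where
  "evb P env e v T \<longleftrightarrow> (\<exists>t\<le>T. eval P env e v t)"

lemma evb_weaken: "evb P env e v t \<Longrightarrow> v = v' \<Longrightarrow> t \<le> t' \<Longrightarrow> evb P env e v' t'"
  unfolding evb_def by (meson order_trans)

lemma evb_Var0: "evb P (x # env) (Var 0) x 1"
  unfolding evb_def using eval.Var[of 0 "x # env" P] by auto

lemma evb_Var1: "evb P (a # x # env) (Var 1) x 1"
  unfolding evb_def using eval.Var[of 1 "a # x # env" P] by auto

lemma evb_Const: "evb P env (Const n) (VNum n) 1"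
  unfolding evb_def using eval.Const[of P env n] by auto

lemma evb_Add: "evb P env a (VNum m) s \<Longrightarrow> evb P env b (VNum n) t \<Longrightarrow>
    evb P env (Add a b) (VNum (m + n)) (s + t + 1)"
  unfolding evb_def by (meson eval.Add add_le_mono le_refl)

lemma evb_MkPair: "evb P env a x s \<Longrightarrow> evb P env b y t \<Longrightarrow>
    evb P env (MkPair a b) (VPair x y) (s + t + 1)"
  unfolding evb_def by (meson eval.MkPair add_le_mono le_refl)

lemma evb_Fst: "evb P env a (VPair x y) s \<Longrightarrow> evb P env (Fst a) x (s + 1)"
  unfolding evb_def by (meson eval.Fst add_le_mono le_refl)

lemma evb_Snd: "evb P env a (VPair x y) s \<Longrightarrow> evb P env (Snd a) y (s + 1)"
  unfolding evb_def by (meson eval.Snd add_le_mono le_refl)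

text \<open>Each branch has to evaluate only under its own guard. Charging the maximum keeps the
  bound independent of the outcome of the test.\<close>

lemma evb_IfLess:
  assumes "evb P env a (VNum m) s" "evb P env b (VNum n) t"
    and "m < n \<Longrightarrow> evb P env c x u" "\<not> m < n \<Longrightarrow> evb P env d y w"
  shows "evb P env (IfLess a b c d) (if m < n then x else y) (s + t + max u w + 1)"
proof -
  have "evb P env (if m < n then c else d) (if m < n then x else y) (max u w)"
    using assms(3,4) by (auto intro: evb_weaken)
  with assms(1,2) show ?thesis
    unfolding evb_def by (meson eval.IfLess add_le_mono le_refl)
qed

text \<open>Moves the conditional below \<open>VNum\<close>: the rules for arithmetic and comparison
  unify only with values of that form.\<close>

lemma evb_IfLess_Num:
  assumes "evb P env a (VNum m) s" "evb P env b (VNum n) t"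
    and "m < n \<Longrightarrow> evb P env c (VNum x) u" "\<not> m < n \<Longrightarrow> evb P env d (VNum y) w"
  shows "evb P env (IfLess a b c d) (VNum (if m < n then x else y)) (s + t + max u w + 1)"
  using evb_IfLess[OF assms] by (rule evb_weaken) auto

text \<open>For a test whose outcome is known, the discarded branch needs no bound. In the main
  function that branch pads groups to \<open>k\<close> vertices, which is too slow when
  \<open>k\<close> is large.\<close>

lemma evb_IfLess_False:
  assumes "evb P env a (VNum m) s" "evb P env b (VNum n) t" "\<not> m < n" "evb P env d y w"
  shows "evb P env (IfLess a b c d) y (s + t + w + 1)"
  using evb_IfLess[OF assms(1,2), of c y w d y w] assms(3,4) by auto

lemma evb_IfLess_True:
  assumes "evb P env a (VNum m) s" "evb P env b (VNum n) t" "m < n" "evb P env c x u"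
  shows "evb P env (IfLess a b c d) x (s + t + u + 1)"
  using evb_IfLess[OF assms(1,2), of c x u d x u] assms(3,4) by auto

lemma evb_IfPair:
  assumes "evb P env a x s" "evb P env (case x of VPair _ _ \<Rightarrow> b | VNum _ \<Rightarrow> c) z t"
  shows "evb P env (IfPair a b c) z (s + t + 1)"
proof -
  obtain t1 t2 where "t1 \<le> s" "eval P env a x t1" "t2 \<le> t"
      "eval P env (case x of VPair _ _ \<Rightarrow> b | VNum _ \<Rightarrow> c) z t2"
    using assms unfolding evb_def by blast
  then have "eval P env (IfPair a b c) z (t1 + t2 + 1)" "t1 + t2 + 1 \<le> s + t + 1"
    by (simp_all add: eval.IfPair[simplified])
  then show ?thesis unfolding evb_def by blast
qed

lemma evb_case_Pair:
  "evb P env b z t \<Longrightarrow> evb P env (case VPair x y of VPair _ _ \<Rightarrow> b | VNum _ \<Rightarrow> c) z t"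
  by simp

lemma evb_case_Num:
  "evb P env c z t \<Longrightarrow> evb P env (case VNum n of VPair _ _ \<Rightarrow> b | VNum _ \<Rightarrow> c) z t"
  by simp

lemma evb_LetIn: "evb P env a x s \<Longrightarrow> evb P (x # env) b z t \<Longrightarrow>
    evb P env (LetIn a b) z (s + t + 1)"
  unfolding evb_def by (meson eval.LetIn add_le_mono le_refl)

lemma evb_Call: "evb P env a x s \<Longrightarrow> f < length P \<Longrightarrow> evb P [x] (P ! f) z t \<Longrightarrow>
    evb P env (Call f a) z (s + t + 1)"
  unfolding evb_def by (meson eval.Call add_le_mono le_refl)

text \<open>Comparison is the only test on numbers, so equality is the failure of both strict
  orders. Each argument may be evaluated twice, whence the factor 2 in the time bound.\<close>

definition EqE :: "expr \<Rightarrow> expr \<Rightarrow> expr" where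
  "EqE a b = IfLess a b (Const 0) (IfLess b a (Const 0) (Const 1))"

lemma evb_EqE:
  assumes "evb P env a (VNum m) s" "evb P env b (VNum n) t"
  shows "evb P env (EqE a b) (VNum (if m = n then 1 else 0)) (2 * s + 2 * t + 3)"
  unfolding EqE_def
  by (rule evb_weaken, rule evb_IfLess[OF assms evb_Const], rule evb_IfLess[OF assms(2,1)])
    (auto intro: evb_Const)

text \<open>Applied repeatedly after \<open>evb_weaken\<close>, these rules run a body symbolically
  with schematic value and time. There remain an equation between results and an inequality between
  numbers of steps.\<close>

lemmas evb_rules = evb_Var0 evb_Var1 evb_Const evb_Add evb_MkPair evb_Fst evb_Snd
  evb_EqE evb_IfLess evb_IfLess_Num evb_IfPair evb_case_Pair evb_case_Num evb_LetIn evb_Call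


section \<open>The algorithm\<close>

type_synonym assoc = "(nat \<times> nat) list"

text \<open>The value 0 stands for "uncoloured"; genuine colours start at 1.\<close>

fun color_of :: "assoc \<Rightarrow> nat \<Rightarrow> nat" where
  "color_of [] x = 0"
| "color_of ((y, c) # cs) x = (if y = x then c else color_of cs x)"

definition recolor :: "nat \<Rightarrow> nat \<Rightarrow> nat \<Rightarrow> nat \<Rightarrow> assoc \<Rightarrow> assoc" where
  "recolor v b u a cs = map (\<lambda>(x, c). (x, if x = v then b else if x = u then a else c)) cs"

fun clash :: "assoc \<Rightarrow> assoc \<Rightarrow> nat \<Rightarrow> nat" where
  "clash [] cs v = 0"
| "clash ((a, b) # es) cs v =
     (if (a = v \<or> b = v) \<and> color_of cs a = color_of cs b then 1 else clash es cs v)"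

definition swapped :: "assoc \<Rightarrow> nat \<Rightarrow> nat \<Rightarrow> assoc" where
  "swapped cs v u = recolor v (color_of cs u) u (color_of cs v) cs"

text \<open>The search is also run for a vertex without a clash. Then the vertex itself is an
  acceptable partner, so no separate test is needed; the empty case is reached only if no partner is
  acceptable.\<close>

fun find_swap :: "nat list \<Rightarrow> assoc \<Rightarrow> nat \<Rightarrow> assoc \<Rightarrow> assoc" where
  "find_swap [] cs v es = cs"
| "find_swap (u # us) cs v es =
     (if clash es (swapped cs v u) v + clash es (swapped cs v u) u < 1 then swapped cs v u
      else find_swap us cs v es)"

fun repair :: "nat list \<Rightarrow> nat list \<Rightarrow> assoc \<Rightarrow> assoc \<Rightarrow> assoc" where
  "repair [] W cs es = cs"
| "repair (v # vs) W cs es = repair vs W (find_swap W cs v es) es"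

fun round_robin :: "nat list \<Rightarrow> nat \<Rightarrow> assoc \<Rightarrow> nat \<Rightarrow> assoc" where
  "round_robin [] c cs k = cs"
| "round_robin (w # W) c cs k = round_robin W (if c < k then c + 1 else 1) ((w, c) # cs) k"

fun color_groups :: "nat list list \<Rightarrow> assoc \<Rightarrow> assoc \<Rightarrow> nat \<Rightarrow> assoc" where
  "color_groups [] cs es k = cs"
| "color_groups (W # Ws) cs es k = color_groups Ws (repair W W (round_robin W 1 cs k) es) es k"

text \<open>For \<open>k \<le> l\<close> the truncated difference is 0 and the group stays as it is.
  The \<open>rev\<close> reflects that the program pushes the dummies one by one onto the
  front.\<close>

definition pad :: "nat list \<Rightarrow> nat \<Rightarrow> nat \<Rightarrow> nat \<Rightarrow> nat list" where
  "pad W l D k = rev [D..<D + (k - l)] @ W"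

text \<open>\<open>W\<close> is the group under construction, \<open>l\<close> its size, and \<open>D\<close> a lower bound for unused dummies.\<close>

fun groups :: "nat list list \<Rightarrow> nat list \<Rightarrow> nat \<Rightarrow> nat \<Rightarrow> nat \<Rightarrow> nat list list" where
  "groups [] W l D k = [pad W l D k]"
| "groups (p # ps) W l D k =
     (if k < l + length p then pad W l D k # groups ps p (length p) (D + k) k
      else groups ps (rev p @ W) (l + length p) D k)"

text \<open>A sum of successors exceeds every entry and is computed with additions alone.\<close>

fun fresh :: "nat list \<Rightarrow> nat" where
  "fresh [] = 0"
| "fresh (x # xs) = x + fresh xs + 1"

definition solve :: "nat list \<Rightarrow> assoc \<Rightarrow> nat list list \<Rightarrow> nat \<Rightarrow> assoc" where
  "solve vs es ps k =
     (if k < length vs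
      then filter (\<lambda>(x, c). x < fresh vs) (color_groups (groups ps [] 0 (fresh vs) k) [] es k)
      else round_robin vs 1 [] k)"

text \<open>The function called \<open>i\<close> below is the \<open>i\<close>-th entry of \<open>prog\<close>. It gets its arguments packed into
  right-nested pairs, and \<open>Var 0\<close> (\<open>Var 1\<close> under a \<open>LetIn\<close>) refers to them.\<close>

definition color_of_body :: expr where
  "color_of_body = IfPair (Fst (Var 0))
     (IfLess (Const 0) (EqE (Fst (Fst (Fst (Var 0)))) (Snd (Var 0)))
        (Snd (Fst (Fst (Var 0))))
        (Call 1 (MkPair (Snd (Fst (Var 0))) (Snd (Var 0)))))
     (Const 0)"

definition recolor_body :: expr where
  "recolor_body = IfPair (Fst (Var 0))
     (MkPair
       (MkPair (Fst (Fst (Fst (Var 0))))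
         (IfLess (Const 0) (EqE (Fst (Fst (Fst (Var 0)))) (Fst (Fst (Snd (Var 0)))))
           (Snd (Fst (Snd (Var 0))))
           (IfLess (Const 0) (EqE (Fst (Fst (Fst (Var 0)))) (Fst (Snd (Snd (Var 0)))))
             (Snd (Snd (Snd (Var 0))))
             (Snd (Fst (Fst (Var 0)))))))
       (Call 2 (MkPair (Snd (Fst (Var 0))) (Snd (Var 0)))))
     (Const 0)"

definition clash_body :: expr where
  "clash_body = IfPair (Fst (Var 0))
     (IfLess (Const 1)
       (Add
         (IfLess (Const 0)
           (Add (EqE (Fst (Fst (Fst (Var 0)))) (Snd (Snd (Var 0))))
                (EqE (Snd (Fst (Fst (Var 0)))) (Snd (Snd (Var 0)))))
           (Const 1) (Const 0))
         (EqE (Call 1 (MkPair (Fst (Snd (Var 0))) (Fst (Fst (Fst (Var 0))))))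
              (Call 1 (MkPair (Fst (Snd (Var 0))) (Snd (Fst (Fst (Var 0))))))))
       (Const 1)
       (Call 3 (MkPair (Snd (Fst (Var 0))) (Snd (Var 0)))))
     (Const 0)"

definition find_swap_body :: expr where
  "find_swap_body = IfPair (Fst (Var 0))
     (LetIn
       (Call 2 (MkPair (Fst (Snd (Var 0)))
         (MkPair
           (MkPair (Fst (Snd (Snd (Var 0))))
             (Call 1 (MkPair (Fst (Snd (Var 0))) (Fst (Fst (Var 0))))))
           (MkPair (Fst (Fst (Var 0)))
             (Call 1 (MkPair (Fst (Snd (Var 0))) (Fst (Snd (Snd (Var 0))))))))))
       (IfLess
         (Add
           (Call 3 (MkPair (Snd (Snd (Snd (Var 1)))) (MkPair (Var 0) (Fst (Snd (Snd (Var 1)))))))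
           (Call 3 (MkPair (Snd (Snd (Snd (Var 1)))) (MkPair (Var 0) (Fst (Fst (Var 1)))))))
         (Const 1)
         (Var 0)
         (Call 4 (MkPair (Snd (Fst (Var 1))) (Snd (Var 1))))))
     (Fst (Snd (Var 0)))"

definition repair_body :: expr where
  "repair_body = IfPair (Fst (Var 0))
     (Call 5 (MkPair (Snd (Fst (Var 0)))
       (MkPair (Fst (Snd (Var 0)))
         (MkPair
           (Call 4 (MkPair (Fst (Snd (Var 0)))
             (MkPair (Fst (Snd (Snd (Var 0))))
               (MkPair (Fst (Fst (Var 0))) (Snd (Snd (Snd (Var 0))))))))
           (Snd (Snd (Snd (Var 0))))))))
     (Fst (Snd (Snd (Var 0))))"

definition round_robin_body :: expr where
  "round_robin_body = IfPair (Fst (Var 0))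
     (Call 6 (MkPair (Snd (Fst (Var 0)))
       (MkPair
         (IfLess (Fst (Snd (Var 0))) (Snd (Snd (Snd (Var 0))))
           (Add (Fst (Snd (Var 0))) (Const 1)) (Const 1))
         (MkPair
           (MkPair (MkPair (Fst (Fst (Var 0))) (Fst (Snd (Var 0)))) (Fst (Snd (Snd (Var 0)))))
           (Snd (Snd (Snd (Var 0))))))))
     (Fst (Snd (Snd (Var 0))))"

definition color_groups_body :: expr where
  "color_groups_body = IfPair (Fst (Var 0))
     (Call 7 (MkPair (Snd (Fst (Var 0)))
       (MkPair
         (Call 5 (MkPair (Fst (Fst (Var 0)))
           (MkPair (Fst (Fst (Var 0)))
             (MkPair
               (Call 6 (MkPair (Fst (Fst (Var 0)))
                 (MkPair (Const 1)
                   (MkPair (Fst (Snd (Var 0))) (Snd (Snd (Snd (Var 0))))))))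
               (Fst (Snd (Snd (Var 0))))))))
         (Snd (Snd (Var 0))))))
     (Fst (Snd (Var 0)))"

definition rev_append_body :: expr where
  "rev_append_body = IfPair (Fst (Var 0))
     (Call 8 (MkPair (Snd (Fst (Var 0))) (MkPair (Fst (Fst (Var 0))) (Snd (Var 0)))))
     (Snd (Var 0))"

definition length_body :: expr where
  "length_body = IfPair (Var 0) (Add (Call 9 (Snd (Var 0))) (Const 1)) (Const 0)"

definition pad_body :: expr where
  "pad_body = IfLess (Fst (Snd (Var 0))) (Snd (Snd (Snd (Var 0))))
     (Call 10 (MkPair (MkPair (Fst (Snd (Snd (Var 0)))) (Fst (Var 0)))
       (MkPair (Add (Fst (Snd (Var 0))) (Const 1))
         (MkPair (Add (Fst (Snd (Snd (Var 0)))) (Const 1)) (Snd (Snd (Snd (Var 0))))))))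
     (Fst (Var 0))"

definition groups_body :: expr where
  "groups_body = IfPair (Fst (Var 0))
     (LetIn (Call 9 (Fst (Fst (Var 0))))
       (IfLess (Snd (Snd (Snd (Snd (Var 1))))) (Add (Fst (Snd (Snd (Var 1)))) (Var 0))
         (MkPair (Call 10 (Snd (Var 1)))
           (Call 11 (MkPair (Snd (Fst (Var 1)))
             (MkPair (Fst (Fst (Var 1)))
               (MkPair (Var 0)
                 (MkPair
                   (Add (Fst (Snd (Snd (Snd (Var 1))))) (Snd (Snd (Snd (Snd (Var 1))))))
                   (Snd (Snd (Snd (Snd (Var 1)))))))))))
         (Call 11 (MkPair (Snd (Fst (Var 1)))
           (MkPair (Call 8 (MkPair (Fst (Fst (Var 1))) (Fst (Snd (Var 1)))))
             (MkPair (Add (Fst (Snd (Snd (Var 1)))) (Var 0))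
               (Snd (Snd (Snd (Var 1))))))))))
     (MkPair (Call 10 (Snd (Var 0))) (Const 0))"

definition filter_body :: expr where
  "filter_body = IfPair (Fst (Var 0))
     (LetIn (Call 12 (MkPair (Snd (Fst (Var 0))) (Snd (Var 0))))
       (IfLess (Fst (Fst (Fst (Var 1)))) (Snd (Var 1))
         (MkPair (Fst (Fst (Var 1))) (Var 0))
         (Var 0)))
     (Const 0)"

definition fresh_body :: expr where
  "fresh_body = IfPair (Var 0)
     (Add (Add (Fst (Var 0)) (Call 13 (Snd (Var 0)))) (Const 1)) (Const 0)"

definition solve_body :: expr where
  "solve_body =
     IfLess (Snd (Snd (Snd (Var 0)))) (Call 9 (Fst (Var 0)))
       (LetIn (Call 13 (Fst (Var 0)))
         (Call 12
           (MkPair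
             (Call 7 (MkPair
               (Call 11 (MkPair (Fst (Snd (Snd (Var 1))))
                 (MkPair (Const 0) (MkPair (Const 0) (MkPair (Var 0) (Snd (Snd (Snd (Var 1)))))))))
               (MkPair (Const 0) (MkPair (Fst (Snd (Var 1))) (Snd (Snd (Snd (Var 1))))))))
             (Var 0))))
       (Call 6 (MkPair (Fst (Var 0))
         (MkPair (Const 1) (MkPair (Const 0) (Snd (Snd (Snd (Var 0))))))))"

definition prog :: "expr list" where
  "prog = [solve_body, color_of_body, recolor_body, clash_body, find_swap_body, repair_body,
     round_robin_body, color_groups_body, rev_append_body, length_body, pad_body, groups_body,
     filter_body, fresh_body]"

lemma length_prog: "0 < length prog" "1 < length prog" "2 < length prog" "3 < length prog"
  "4 < length prog" "5 < length prog" "6 < length prog" "7 < length prog" "8 < length prog"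
  "9 < length prog" "10 < length prog" "11 < length prog" "12 < length prog" "13 < length prog"
  by (simp_all add: prog_def)

lemma prog_nth: "prog ! 0 = solve_body" "prog ! 1 = color_of_body" "prog ! 2 = recolor_body"
  "prog ! 3 = clash_body" "prog ! 4 = find_swap_body" "prog ! 5 = repair_body"
  "prog ! 6 = round_robin_body" "prog ! 7 = color_groups_body" "prog ! 8 = rev_append_body"
  "prog ! 9 = length_body" "prog ! 10 = pad_body" "prog ! 11 = groups_body"
  "prog ! 12 = filter_body" "prog ! 13 = fresh_body"
  by (simp_all add: prog_def)

section \<open>Running times of the individual functions\<close>

abbreviation enc_nats :: "nat list \<Rightarrow> val" where "enc_nats \<equiv> enc_list VNum"
abbreviation enc_assoc :: "assoc \<Rightarrow> val" where "enc_assoc \<equiv> enc_list enc_nat_pair"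

lemma enc_nat_pair_Pair: "enc_nat_pair (a, b) = VPair (VNum a) (VNum b)"
  by (simp add: enc_nat_pair_def)

lemmas enc_simps = enc_list.simps enc_nat_pair_Pair

lemma evb_color_of:
  "evb prog [VPair (enc_assoc cs) (VNum x)] (prog ! 1) (VNum (color_of cs x)) (40 * length cs + 40)"
proof (induction cs)
  case Nil
  show ?case unfolding prog_nth color_of_body_def enc_simps
    by (rule evb_weaken, (rule evb_rules length_prog)+) simp_all
next
  case (Cons p cs)
  obtain a c where p: "p = (a, c)" by (cases p)
  show ?case unfolding prog_nth color_of_body_def enc_simps p
    by (rule evb_weaken, (rule evb_rules length_prog Cons.IH)+) simp_all
qed


lemma recolor_simps:
  "recolor v b u a [] = []"
  "recolor v b u a ((x, c) # cs) =
     (x, if x = v then b else if x = u then a else c) # recolor v b u a cs"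
  by (simp_all add: recolor_def)

lemma evb_recolor:
  "evb prog [VPair (enc_assoc cs) (VPair (VPair (VNum v) (VNum b)) (VPair (VNum u) (VNum a)))]
     (prog ! 2) (enc_assoc (recolor v b u a cs)) (90 * length cs + 90)"
proof (induction cs)
  case Nil
  show ?case unfolding prog_nth recolor_body_def enc_simps recolor_simps
    by (rule evb_weaken, (rule evb_rules length_prog)+) simp_all
next
  case (Cons p cs)
  obtain x c where p: "p = (x, c)" by (cases p)
  show ?case unfolding prog_nth recolor_body_def enc_simps recolor_simps p
    by (rule evb_weaken, (rule evb_rules length_prog Cons.IH)+) simp_all
qed

lemma evb_clash:
  "evb prog [VPair (enc_assoc es) (VPair (enc_assoc cs) (VNum v))] (prog ! 3)
     (VNum (clash es cs v)) (400 * (length cs + 1) * (length es + 1))"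
proof (induction es)
  case Nil
  show ?case unfolding prog_nth clash_body_def enc_simps
    by (rule evb_weaken, (rule evb_rules length_prog)+) simp_all
next
  case (Cons p es)
  obtain a b where p: "p = (a, b)" by (cases p)
  show ?case unfolding prog_nth clash_body_def enc_simps p
    by (rule evb_weaken, (rule evb_rules length_prog Cons.IH evb_color_of)+)
      (simp_all add: algebra_simps)
qed

lemma length_recolor [simp]: "length (recolor v b u a cs) = length cs"
  by (simp add: recolor_def)

lemma length_swapped [simp]: "length (swapped cs v u) = length cs"
  by (simp add: swapped_def)

lemma length_find_swap [simp]: "length (find_swap us cs v es) = length cs"
  by (induction us) auto

lemma length_repair [simp]: "length (repair vs W cs es) = length cs"
  by (induction vs arbitrary: cs) auto

lemma length_round_robin [simp]: "length (round_robin W c cs k) = length W + length cs"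
  by (induction W arbitrary: c cs) auto

lemma length_color_groups:
  "length (color_groups Ws cs es k) = length (concat Ws) + length cs"
  by (induction Ws arbitrary: cs) auto

lemma evb_find_swap:
  "evb prog [VPair (enc_nats us) (VPair (enc_assoc cs) (VPair (VNum v) (enc_assoc es)))]
     (prog ! 4) (enc_assoc (find_swap us cs v es))
     (2000 * (length cs + 1) * (length es + 1) * (length us + 1))"
proof (induction us)
  case Nil
  show ?case unfolding prog_nth find_swap_body_def enc_simps
    by (rule evb_weaken, (rule evb_rules length_prog)+) simp_all
next
  case (Cons u us)
  show ?case unfolding prog_nth find_swap_body_def enc_simps
    by (rule evb_weaken, (rule evb_rules length_prog Cons.IH evb_color_of evb_recolor
          evb_clash)+)
      (simp_all add: algebra_simps swapped_def)
qed

lemma evb_repair: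
  "evb prog [VPair (enc_nats vs) (VPair (enc_nats W) (VPair (enc_assoc cs) (enc_assoc es)))]
     (prog ! 5) (enc_assoc (repair vs W cs es))
     (2100 * (length cs + 1) * (length es + 1) * (length W + 1) * (length vs + 1))"
proof (induction vs arbitrary: cs)
  case Nil
  show ?case unfolding prog_nth repair_body_def enc_simps
    by (rule evb_weaken, (rule evb_rules length_prog)+) simp_all
next
  case (Cons v vs)
  show ?case unfolding prog_nth repair_body_def enc_simps
    by (rule evb_weaken, (rule evb_rules length_prog Cons.IH evb_find_swap)+)
      (simp_all add: algebra_simps)
qed

lemma evb_round_robin:
  "evb prog [VPair (enc_nats W) (VPair (VNum c) (VPair (enc_assoc cs) (VNum k)))]
     (prog ! 6) (enc_assoc (round_robin W c cs k)) (60 * length W + 60)"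
proof (induction W arbitrary: c cs)
  case Nil
  show ?case unfolding prog_nth round_robin_body_def enc_simps
    by (rule evb_weaken, (rule evb_rules length_prog)+) simp_all
next
  case (Cons w W)
  \<comment> \<open>The conditional has to stand outside \<open>VNum\<close>, as
    \<open>evb_IfLess\<close> produces it for a component of a pair.\<close>
  have *: "evb prog [VPair (enc_nats W) (VPair (if c < k then VNum (c + 1) else VNum 1)
       (VPair (VPair (VPair (VNum w) (VNum c)) (enc_assoc cs)) (VNum k)))]
     (prog ! 6) (enc_assoc (round_robin (w # W) c cs k)) (60 * length W + 60)"
    using Cons.IH[of "if c < k then c + 1 else 1" "(w, c) # cs"]
    by (simp add: enc_nat_pair_Pair split: if_splits)
  show ?case unfolding prog_nth round_robin_body_def enc_simps
    by (rule evb_weaken, (rule evb_rules length_prog *)+) simp_all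
qed

text \<open>The association list grows from group to group, but its length plus the number of
  vertices still to come is constant. Hence one \<open>L\<close> bounds all lists that
  occur.\<close>

lemma evb_color_groups:
  assumes "length cs + length (concat Ws) \<le> L"
  shows "evb prog [VPair (enc_list enc_nats Ws)
       (VPair (enc_assoc cs) (VPair (enc_assoc es) (VNum k)))]
     (prog ! 7) (enc_assoc (color_groups Ws cs es k))
     (2300 * (L + 1) ^ 3 * (length es + 1) * (length Ws + 1))"
  using assms
proof (induction Ws arbitrary: cs)
  case Nil
  have "(0::nat) < (L + 1) ^ 3 * (length es + 1)" by simp
  then have *: "1 \<le> (L + 1) ^ 3 * (length es + 1)" by linarith
  show ?case unfolding prog_nth color_groups_body_def enc_simps
    by (rule evb_weaken, (rule evb_rules length_prog)+)
      (use * in \<open>simp_all add: mult.assoc\<close>)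
next
  case (Cons W Ws)
  define es' where "es' = length es + 1"
  have IH: "evb prog [VPair (enc_list enc_nats Ws)
       (VPair (enc_assoc (repair W W (round_robin W 1 cs k) es)) (VPair (enc_assoc es) (VNum k)))]
     (prog ! 7) (enc_assoc (color_groups (W # Ws) cs es k))
     (2300 * (L + 1) ^ 3 * (length es + 1) * (length Ws + 1))"
    using Cons.IH[of "repair W W (round_robin W 1 cs k) es"] Cons.prems by simp
  \<comment> \<open>The cube arises from three nested traversals: the vertices to repair, their
    candidate partners, and the list in which colours are looked up.\<close>
  have "(length W + length cs + 1) * es' * (length W + 1) * (length W + 1)
      \<le> (L + 1) * es' * (L + 1) * (L + 1)"
    using Cons.prems by (intro mult_le_mono) auto
  then have 1: "(length W + length cs + 1) * es' * (length W + 1) * (length W + 1)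
      \<le> (L + 1) ^ 3 * es'"
    by (simp only: power3_eq_cube ac_simps)
  have "(L + 1) * 1 \<le> (L + 1) * ((L + 1) ^ 2 * es')"
    by (intro mult_le_mono) (auto simp: es'_def Suc_le_eq)
  moreover have "(L + 1) * ((L + 1) ^ 2 * es') = (L + 1) ^ 3 * es'"
    by (simp only: power3_eq_cube power2_eq_square ac_simps)
  ultimately have 2: "length W + 1 \<le> (L + 1) ^ 3 * es'"
    using Cons.prems by simp
  define Y where "Y = (L + 1) ^ 3 * es'"
  have rep: "evb prog [VPair (enc_nats W) (VPair (enc_nats W)
      (VPair (enc_assoc (round_robin W 1 cs k)) (enc_assoc es)))]
     (prog ! 5) (enc_assoc (repair W W (round_robin W 1 cs k) es)) (2100 * Y)"
    by (rule evb_weaken[OF evb_repair])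
      (use 1 in \<open>simp_all only: Y_def es'_def length_round_robin mult.assoc mult_le_mono2\<close>)
  have eq: "2300 * (L + 1) ^ 3 * (length es + 1) * (length (W # Ws) + 1) =
      2300 * Y * (length Ws + 1) + 2300 * Y"
    by (simp add: Y_def es'_def algebra_simps)
  have IH': "evb prog [VPair (enc_list enc_nats Ws)
       (VPair (enc_assoc (repair W W (round_robin W 1 cs k) es)) (VPair (enc_assoc es) (VNum k)))]
     (prog ! 7) (enc_assoc (color_groups (W # Ws) cs es k)) (2300 * Y * (length Ws + 1))"
    using IH by (simp only: Y_def es'_def mult.assoc)
  have "length W + 1 \<le> Y" using 2 by (simp add: Y_def)
  show ?case unfolding prog_nth color_groups_body_def enc_simps eq
    by (rule evb_weaken, (rule evb_rules length_prog IH' rep evb_round_robin)+)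
      (use \<open>length W + 1 \<le> Y\<close> in simp_all)
qed

lemma evb_rev_append:
  "evb prog [VPair (enc_nats xs) (enc_nats ys)] (prog ! 8) (enc_nats (rev xs @ ys))
     (20 * length xs + 20)"
proof (induction xs arbitrary: ys)
  case Nil
  show ?case unfolding prog_nth rev_append_body_def enc_simps
    by (rule evb_weaken, (rule evb_rules length_prog)+) simp_all
next
  case (Cons x xs)
  show ?case unfolding prog_nth rev_append_body_def enc_simps
    by (rule evb_weaken, (rule evb_rules length_prog Cons.IH[of "x # ys", unfolded enc_simps])+) simp_all
qed

lemma evb_length:
  "evb prog [enc_nats xs] (prog ! 9) (VNum (length xs)) (10 * length xs + 10)"
proof (induction xs)
  case Nil
  show ?case unfolding prog_nth length_body_def enc_simps
    by (rule evb_weaken, (rule evb_rules length_prog)+) simp_all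
next
  case (Cons x xs)
  show ?case unfolding prog_nth length_body_def enc_simps
    by (rule evb_weaken, (rule evb_rules length_prog Cons.IH)+) simp_all
qed

lemma evb_pad:
  "evb prog [VPair (enc_nats W) (VPair (VNum l) (VPair (VNum D) (VNum k)))] (prog ! 10)
     (enc_nats (pad W l D k)) (50 * (k - l) + 50)"
proof (induction "k - l" arbitrary: W l D)
  case 0
  then have "\<not> l < k" by simp
  show ?case unfolding prog_nth pad_body_def
    by (rule evb_weaken, rule evb_IfLess_False, (rule evb_rules \<open>\<not> l < k\<close>)+)
      (use \<open>\<not> l < k\<close> in \<open>auto simp: pad_def\<close>)
next
  case (Suc m)
  then have l: "l < k" by simp
  have "D + 1 + (k - (l + 1)) = D + (k - l)" using l by simp
  then have "pad (D # W) (l + 1) (D + 1) k = pad W l D k"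
    unfolding pad_def using l by (simp only: upt_conv_Cons[of D]) simp
  with Suc.hyps(1)[of "l + 1" "D # W" "D + 1"] Suc.hyps(2)
  have *: "evb prog [VPair (VPair (VNum D) (enc_nats W))
        (VPair (VNum (l + 1)) (VPair (VNum (D + 1)) (VNum k)))] (prog ! 10)
     (enc_nats (pad W l D k)) (50 * (k - (l + 1)) + 50)"
    by simp
  show ?case unfolding prog_nth pad_body_def
    by (rule evb_weaken, (rule evb_rules length_prog *)+)
      (use l in \<open>simp_all\<close>)
qed

lemma evb_groups:
  "evb prog [VPair (enc_list enc_nats ps)
       (VPair (enc_nats W) (VPair (VNum l) (VPair (VNum D) (VNum k))))] (prog ! 11)
     (enc_list enc_nats (groups ps W l D k))
     (200 * (length (concat ps) + (k + 1) * (length ps + 1)))"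
proof (induction ps arbitrary: W l D)
  case Nil
  show ?case unfolding prog_nth groups_body_def enc_simps
    by (rule evb_weaken, (rule evb_rules length_prog evb_pad)+) simp_all
next
  case (Cons p ps)
  show ?case unfolding prog_nth groups_body_def enc_simps
    by (rule evb_weaken, (rule evb_rules length_prog Cons.IH evb_pad evb_rev_append evb_length)+) (simp_all add: algebra_simps)
qed

lemma evb_filter:
  "evb prog [VPair (enc_assoc cs) (VNum D)] (prog ! 12)
     (enc_assoc (filter (\<lambda>(x, c). x < D) cs)) (40 * length cs + 40)"
proof (induction cs)
  case Nil
  show ?case unfolding prog_nth filter_body_def enc_simps
    by (rule evb_weaken, (rule evb_rules length_prog)+) simp_all
next
  case (Cons p cs)
  obtain a c where p: "p = (a, c)" by (cases p)
  show ?case unfolding prog_nth filter_body_def enc_simps p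
    by (rule evb_weaken, (rule evb_rules length_prog Cons.IH)+)
      (simp_all add: enc_nat_pair_Pair)
qed

lemma evb_fresh:
  "evb prog [enc_nats xs] (prog ! 13) (VNum (fresh xs)) (20 * length xs + 20)"
proof (induction xs)
  case Nil
  show ?case unfolding prog_nth fresh_body_def enc_simps
    by (rule evb_weaken, (rule evb_rules length_prog)+) simp_all
next
  case (Cons x xs)
  show ?case unfolding prog_nth fresh_body_def enc_simps
    by (rule evb_weaken, (rule evb_rules length_prog Cons.IH)+) simp_all
qed

section \<open>Size of the padded groups and total running time\<close>

lemma length_groups_le: "length (groups ps W l D k) \<le> length ps + 1"
  by (induction ps arbitrary: W l D) (auto intro: le_SucI)

lemma length_concat_groups_le:
  "length (concat (groups ps W l D k)) \<le> length W + length (concat ps) + k * (length ps + 1)"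
proof (induction ps arbitrary: W l D)
  case (Cons p ps)
  show ?case
    using Cons.IH[of p "length p" "D + k"] Cons.IH[of "rev p @ W" "l + length p" D]
    by (auto simp: pad_def)
qed (simp add: pad_def)

lemma evb_solve:
  assumes "length vs \<le> S" "length es \<le> S" "length ps \<le> S" "length (concat ps) \<le> S" "1 \<le> S"
  shows "evb prog [VPair (enc_nats vs) (VPair (enc_assoc es)
      (VPair (enc_list enc_nats ps) (VNum k)))] (prog ! 0) (enc_assoc (solve vs es ps k))
     (1000000 * S ^ 8)"
proof (cases "k < length vs")
  case True
  define Ws where "Ws = groups ps [] 0 (fresh vs) k"
  \<comment> \<open>At most \<open>S\<close> vertices, and at most \<open>k < S\<close> dummies in
    each of at most \<open>2 * S\<close> groups.\<close>
  define L where "L = 3 * S ^ 2"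
  have S2: "S \<le> S ^ 2" "1 \<le> S ^ 2" using \<open>1 \<le> S\<close> by (auto simp: power2_eq_square)
  have S8: "S ^ 2 \<le> S ^ 8" by (rule power_increasing) (use assms in auto)
  have kps: "k * (length ps + 1) \<le> S * (2 * S)" "(k + 1) * (length ps + 1) \<le> (2 * S) * (2 * S)"
    by (rule mult_le_mono; use True assms in linarith)+
  have Ws: "length Ws + 1 \<le> 3 * S" "length (concat Ws) \<le> L"
    using length_groups_le[of ps "[]" 0 "fresh vs" k]
      length_concat_groups_le[of ps "[]" 0 "fresh vs" k] assms kps S2
    unfolding Ws_def L_def power2_eq_square list.size by linarith+
  have "L + 1 \<le> 4 * S ^ 2" using S2 by (simp add: L_def)
  \<comment> \<open>Exponent 8: the cube of a list length of order \<open>S ^ 2\<close>, one factor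
    for the edges and one for the groups.\<close>
  then have "(L + 1) ^ 3 * (length es + 1) * (length Ws + 1)
      \<le> (4 * S ^ 2) ^ 3 * (2 * S) * (3 * S)"
    using Ws assms by (intro mult_le_mono power_mono) auto
  also have "\<dots> = 384 * S ^ 8"
    by (simp add: power_mult_distrib flip: power_mult power_add) (simp add: eval_nat_numeral)
  finally have main: "2300 * (L + 1) ^ 3 * (length es + 1) * (length Ws + 1) \<le> 883200 * S ^ 8"
    unfolding mult.assoc by linarith
  have gr: "200 * (length (concat ps) + (k + 1) * (length ps + 1)) \<le> 1000 * S ^ 2"
    using assms(4) mult_le_mono2[OF kps(2), of 200] S2
    unfolding power2_eq_square distrib_left[of 200] by linarith
  have len: "length (color_groups Ws [] es k) \<le> L" 
    using Ws(2) by (simp add: length_color_groups)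
  have cg: "evb prog [VPair (enc_list enc_nats Ws) (VPair (VNum 0) (VPair (enc_assoc es) (VNum k)))]
     (prog ! 7) (enc_assoc (color_groups Ws [] es k))
     (2300 * (L + 1) ^ 3 * (length es + 1) * (length Ws + 1))"
    using evb_color_groups[of "[]" Ws L es k] Ws by simp
  have gs: "evb prog [VPair (enc_list enc_nats ps)
       (VPair (VNum 0) (VPair (VNum 0) (VPair (VNum (fresh vs)) (VNum k))))] (prog ! 11)
     (enc_list enc_nats Ws) (200 * (length (concat ps) + (k + 1) * (length ps + 1)))"
    using evb_groups[of ps "[]" 0 "fresh vs" k] by (simp add: Ws_def)
  show ?thesis unfolding prog_nth solve_body_def
    apply (rule evb_weaken, rule evb_IfLess_True)
          apply ((rule evb_rules length_prog evb_length True evb_fresh cg gs evb_filter)+)[4]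
      apply (use True in \<open>simp add: solve_def Ws_def\<close>)
    using main gr len assms S2 S8 unfolding L_def by linarith
next
  case False
  have rr: "evb prog [VPair (enc_nats vs) (VPair (VNum 1) (VPair (VNum 0) (VNum k)))]
     (prog ! 6) (enc_assoc (round_robin vs 1 [] k)) (60 * length vs + 60)"
    using evb_round_robin[of vs 1 "[]" k] by simp
  have "S ^ 1 \<le> S ^ 8" by (rule power_increasing) (use assms in auto)
  then show ?thesis unfolding prog_nth solve_body_def
    apply -
    apply (rule evb_weaken, rule evb_IfLess_False)
          apply ((rule evb_rules length_prog evb_length False rr)+)[4]
      apply (use False in \<open>simp add: solve_def\<close>)
    using assms by simp
qed

section \<open>Colour swaps\<close>

abbreviation keys :: "assoc \<Rightarrow> nat set" where "keys cs \<equiv> fst ` set cs"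

lemma color_of_notin: "x \<notin> keys cs \<Longrightarrow> color_of cs x = 0"
  by (induction cs x rule: color_of.induct) auto

lemma color_of_recolor:
  "color_of (recolor v b u a cs) x =
     (if x \<notin> keys cs then 0 else if x = v then b else if x = u then a else color_of cs x)"
  by (induction cs) (force simp: recolor_def)+

lemma map_fst_swapped [simp]: "map fst (swapped cs v u) = map fst cs"
  by (induction cs) (auto simp: recolor_def swapped_def)

lemma keys_swapped [simp]: "keys (swapped cs v u) = keys cs"
  by (metis list.set_map map_fst_swapped)

lemma color_of_swapped:
  assumes "v \<in> keys cs" "u \<in> keys cs"
  shows "color_of (swapped cs v u) = color_of cs \<circ> transpose v u"
proof
  fix x
  show "color_of (swapped cs v u) x = (color_of cs \<circ> transpose v u) x"
    using assms by (auto simp: swapped_def color_of_recolor transpose_def color_of_notin)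
qed

definition nbrs :: "assoc \<Rightarrow> nat \<Rightarrow> nat set" where
  "nbrs es x = {y. (x, y) \<in> set es \<or> (y, x) \<in> set es}"

lemma nbrs_sym: "y \<in> nbrs es x \<longleftrightarrow> x \<in> nbrs es y"
  by (auto simp: nbrs_def)

lemma finite_nbrs [simp]: "finite (nbrs es x)"
  by (rule finite_subset[of _ "fst ` set es \<union> snd ` set es"]) (force simp: nbrs_def)+

lemma clash_eq_0_iff: "clash es cs v = 0 \<longleftrightarrow> (\<forall>y\<in>nbrs es v. color_of cs v \<noteq> color_of cs y)"
proof (induction es)
  case (Cons p es)
  obtain a b where p: "p = (a, b)" by (cases p)
  have "nbrs ((a, b) # es) v =
      nbrs es v \<union> (if a = v then {b} else {}) \<union> (if b = v then {a} else {})"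
    by (auto simp: nbrs_def)
  then show ?case using Cons.IH unfolding p by auto
qed (simp add: nbrs_def)

text \<open>The transposition permutes \<open>X\<close>, since both points lie in it. With
  \<open>X\<close> a group this preserves balance, and with \<open>X\<close> the set of all coloured
  vertices it preserves the class sizes.\<close>

lemma card_color_transpose:
  assumes "u \<in> X" "v \<in> X"
  shows "card {x\<in>X. (f \<circ> transpose u v) x = i} = card {x\<in>X. f x = i}"
proof -
  have "{x\<in>X. (f \<circ> transpose u v) x = i} = transpose u v ` {x\<in>X. f x = i}"
  proof (intro set_eqI iffI)
    fix x assume "x \<in> {x\<in>X. (f \<circ> transpose u v) x = i}"
    then show "x \<in> transpose u v ` {x\<in>X. f x = i}"
      using assms by (intro image_eqI[of _ _ "transpose u v x"]) (auto simp: transpose_def)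
  qed (use assms in \<open>auto simp: transpose_def\<close>)
  moreover have "inj_on (transpose u v) {x\<in>X. f x = i}"
    by (rule inj_onI) (metis transpose_involutory)
  ultimately show ?thesis by (simp add: card_image)
qed

lemma card_UN_le_mult:
  assumes "finite I" "\<And>i. i \<in> I \<Longrightarrow> card (A i) \<le> m"
  shows "card (\<Union>i\<in>I. A i) \<le> card I * m"
proof -
  have "card (\<Union>i\<in>I. A i) \<le> (\<Sum>i\<in>I. card (A i))"
    by (rule card_UN_le[OF assms(1)])
  also have "\<dots> \<le> card I * m" using sum_bounded_above[of I "\<lambda>i. card (A i)" m] assms(2) by simp
  finally show ?thesis .
qed

text \<open>A vertex of \<open>W\<close> is a bad swap partner for \<open>v\<close> only if it shares its colour with a neighbour
  of \<open>v\<close> (at most \<open>\<Delta> * n\<close> vertices, \<open>v\<close> among them when it clashes) or has a neighbour of the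
  colour of \<open>v\<close> (at most \<open>\<Delta> * N\<close> vertices).\<close>

lemma ex_swap_partner:
  assumes K: "finite K" "W \<subseteq> K" "v \<in> W" "\<And>x. c x = 0 \<longleftrightarrow> x \<notin> K"
    and deg: "\<And>x. card (nbrs es x) \<le> \<Delta>" "\<And>x. x \<notin> nbrs es x"
    and n: "\<And>i. card {x\<in>W. c x = i} \<le> n"
    and N: "\<And>i. i \<noteq> 0 \<Longrightarrow> card {x\<in>K. c x = i} \<le> N"
    and lt: "\<Delta> * (n + N) < card W"
  shows "\<exists>u\<in>W. (\<forall>y\<in>nbrs es v. (c \<circ> transpose v u) v \<noteq> (c \<circ> transpose v u) y) \<and>
               (\<forall>y\<in>nbrs es u. (c \<circ> transpose v u) u \<noteq> (c \<circ> transpose v u) y)"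
proof (cases "\<forall>y\<in>nbrs es v. c v \<noteq> c y")
  case True
  \<comment> \<open>Swapping \<open>v\<close> with itself changes nothing.\<close>
  then show ?thesis using K(3) by (intro bexI[of _ v]) auto
next
  case False
  then obtain y0 where y0: "y0 \<in> nbrs es v" "c y0 = c v" by auto
  define B1 where "B1 = (\<Union>y\<in>nbrs es v. {x\<in>W. c x = c y})"
  define B2 where "B2 = (\<Union>y\<in>{x\<in>K. c x = c v}. nbrs es y)"
  have cv: "c v \<noteq> 0" using K by auto
  have "card B1 \<le> card (nbrs es v) * n"
    unfolding B1_def by (rule card_UN_le_mult) (use n in auto)
  also have "\<dots> \<le> \<Delta> * n" using deg by simp
  finally have 1: "card B1 \<le> \<Delta> * n" .
  have "card B2 \<le> card {x\<in>K. c x = c v} * \<Delta>"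
    unfolding B2_def by (rule card_UN_le_mult) (use K deg in auto)
  also have "\<dots> \<le> N * \<Delta>" using N cv by simp
  finally have 2: "card B2 \<le> N * \<Delta>" .
  have "card (B1 \<union> B2) \<le> card B1 + card B2" by (rule card_Un_le)
  also have "\<dots> < card W" using 1 2 lt by (simp add: algebra_simps)
  finally have "card (B1 \<union> B2) < card W" .
  moreover have "finite (B1 \<union> B2)"
    using K finite_subset[of W K] by (auto simp: B1_def B2_def)
  ultimately have "\<not> W \<subseteq> B1 \<union> B2" by (meson card_mono linorder_not_less)
  then obtain u where u: "u \<in> W" "u \<notin> B1" "u \<notin> B2" by blast
  have uv: "c u \<noteq> c v" using u(1,2) y0 by (auto simp: B1_def)
  \<comment> \<open>In particular \<open>u\<close> is no neighbour of \<open>v\<close>, since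
    \<open>B1\<close> contains every neighbour of \<open>v\<close> in \<open>W\<close>. So the
    neighbours of either vertex keep their colours in the swap.\<close>
  have "c u \<noteq> c y" if "y \<in> nbrs es v" for y
    using that u by (auto simp: B1_def)
  moreover have "c v \<noteq> c y" if "y \<in> nbrs es u" for y
  proof
    assume "c v = c y"
    \<comment> \<open>As \<open>c v\<close> is not the default 0, a vertex of this colour is a
      coloured one and is counted in \<open>B2\<close>.\<close>
    then have "y \<in> K" using cv K(4) by metis
    then show False using \<open>c v = c y\<close> u(3) that nbrs_sym by (auto simp: B2_def)
  qed
  ultimately show ?thesis
    using u(1) uv deg(2) by (intro bexI[of _ u]) (auto simp: transpose_def)
qed

lemma find_swap_finds:
  assumes "\<exists>u\<in>set us. clash es (swapped cs v u) v = 0 \<and> clash es (swapped cs v u) u = 0"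
  shows "\<exists>u\<in>set us. find_swap us cs v es = swapped cs v u \<and>
    clash es (swapped cs v u) v = 0 \<and> clash es (swapped cs v u) u = 0"
  using assms by (induction us) auto


section \<open>Balanced colourings of groups\<close>

definition ceil_div :: "nat \<Rightarrow> nat \<Rightarrow> nat" where
  "ceil_div n k = (n + k - 1) div k"

lemma ceil_div_bounds:
  assumes "0 < k"
  shows "k * ceil_div n k < n + k" "n \<le> k * ceil_div n k"
proof -
  have "k * ceil_div n k \<le> n + k - 1" unfolding ceil_div_def by simp
  then show "k * ceil_div n k < n + k" using assms by linarith
  have "n + k - 1 < k * ceil_div n k + k"
    unfolding ceil_div_def using assms by (metis add.commute mult.commute dividend_less_times_div)
  then show "n \<le> k * ceil_div n k" using assms by linarith
qed

lemma ceil_div_self: "0 < k \<Longrightarrow> ceil_div k k = 1"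
  unfolding ceil_div_def by (rule div_nat_eqI) auto

definition balanced_on :: "nat \<Rightarrow> (nat \<Rightarrow> nat) \<Rightarrow> nat set \<Rightarrow> bool" where
  "balanced_on k f X \<longleftrightarrow> (\<forall>x\<in>X. 1 \<le> f x \<and> f x \<le> k) \<and>
     (\<forall>i. card {x\<in>X. f x = i} \<le> ceil_div (card X) k) \<and>
     (\<forall>i\<in>{1..k}. card X div k \<le> card {x\<in>X. f x = i})"

lemma balanced_on_transpose:
  assumes "balanced_on k f X" "u \<in> X" "v \<in> X"
  shows "balanced_on k (f \<circ> transpose u v) X"
  using assms(1) unfolding balanced_on_def card_color_transpose[OF assms(2,3)]
  using assms(2,3) by (auto simp: transpose_def)

lemma balanced_on_cong: "(\<And>x. x \<in> X \<Longrightarrow> f x = g x) \<Longrightarrow> balanced_on k f X \<longleftrightarrow> balanced_on k g X"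
proof -
  assume *: "\<And>x. x \<in> X \<Longrightarrow> f x = g x"
  then have "{x\<in>X. f x = i} = {x\<in>X. g x = i}" for i by auto
  with * show ?thesis unfolding balanced_on_def by simp
qed

text \<open>Colour 0 is exempt because edges between vertices that are not coloured yet must not
  count as clashes.\<close>

definition proper :: "assoc \<Rightarrow> assoc \<Rightarrow> bool" where
  "proper es cs \<longleftrightarrow> (\<forall>(a, b)\<in>set es. color_of cs a = color_of cs b \<longrightarrow> color_of cs a = 0)"

definition class_bound :: "nat \<Rightarrow> assoc \<Rightarrow> bool" where
  "class_bound N cs \<longleftrightarrow> (\<forall>x\<in>keys cs. color_of cs x \<noteq> 0) \<and>
     (\<forall>i. card {x\<in>keys cs. color_of cs x = i} \<le> N)"

lemma repair_correct:
  assumes deg: "\<And>x. card (nbrs es x) \<le> \<Delta>" "\<And>x. x \<notin> nbrs es x"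
    and lt: "\<Delta> * (ceil_div (card (set W)) k + N) < card (set W)"
    and "set vs \<subseteq> set W" "set W \<subseteq> keys cs"
    and "balanced_on k (color_of cs) (set W)" "class_bound N cs"
    and "\<And>a b. (a, b) \<in> set es \<Longrightarrow> color_of cs a = color_of cs b \<Longrightarrow>
      color_of cs a = 0 \<or> a \<in> set vs \<or> b \<in> set vs"
  shows "map fst (repair vs W cs es) = map fst cs \<and>
    (\<forall>x. x \<notin> set W \<longrightarrow> color_of (repair vs W cs es) x = color_of cs x) \<and>
    balanced_on k (color_of (repair vs W cs es)) (set W) \<and>
    class_bound N (repair vs W cs es) \<and> proper es (repair vs W cs es)"
  using assms(4-)
proof (induction vs arbitrary: cs)
  case Nil
  then show ?case by (auto simp: proper_def)
next
  case (Cons v vs)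
  have "\<exists>u\<in>set W. (\<forall>y\<in>nbrs es v. (color_of cs \<circ> transpose v u) v \<noteq> (color_of cs \<circ> transpose v u) y)
      \<and> (\<forall>y\<in>nbrs es u. (color_of cs \<circ> transpose v u) u \<noteq> (color_of cs \<circ> transpose v u) y)"
  proof (rule ex_swap_partner[where K = "keys cs", OF _ _ _ _ deg _ _ lt])
    show "color_of cs x = 0 \<longleftrightarrow> x \<notin> keys cs" for x
      using Cons.prems(4) color_of_notin[of x cs] by (auto simp: class_bound_def)
  qed (use Cons.prems in \<open>auto simp: class_bound_def balanced_on_def\<close>)
  then have "\<exists>u\<in>set W. clash es (swapped cs v u) v = 0 \<and> clash es (swapped cs v u) u = 0"
    unfolding clash_eq_0_iff using Cons.prems(1,2) by (metis color_of_swapped list.set_intros(1) subsetD)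
  from find_swap_finds[OF this] obtain u where u: "u \<in> set W"
    "find_swap W cs v es = swapped cs v u"
    "clash es (swapped cs v u) v = 0" "clash es (swapped cs v u) u = 0" by blast
  define cs' where "cs' = swapped cs v u"
  have vu: "v \<in> keys cs" "u \<in> keys cs" "v \<in> set W" using u(1) Cons.prems(1,2) by auto
  have col: "color_of cs' = color_of cs \<circ> transpose v u"
    unfolding cs'_def using vu by (intro color_of_swapped)
  have keys: "keys cs' = keys cs" "map fst cs' = map fst cs" by (simp_all add: cs'_def)
  have bal: "balanced_on k (color_of cs') (set W)"
    unfolding col using Cons.prems(3) vu u(1) by (intro balanced_on_transpose)
  have cb: "class_bound N cs'"
    using Cons.prems(4) vu unfolding class_bound_def keys col card_color_transpose[OF vu(1,2)]
    by (auto simp: transpose_def)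
  have conf: "color_of cs' a = 0 \<or> a \<in> set vs \<or> b \<in> set vs"
    if ab: "(a, b) \<in> set es" "color_of cs' a = color_of cs' b" for a b
  proof -
    have nb: "a \<in> nbrs es b" "b \<in> nbrs es a" using ab(1) by (auto simp: nbrs_def)
    have "a \<notin> {u, v}" "b \<notin> {u, v}"
      using u(3,4) nb ab(2) unfolding clash_eq_0_iff cs'_def[symmetric] by auto
    then have "color_of cs' a = color_of cs a" "color_of cs' b = color_of cs b"
      unfolding col by (auto simp: transpose_def)
    with Cons.prems(5)[OF ab(1)] ab(2) \<open>a \<notin> {u, v}\<close> \<open>b \<notin> {u, v}\<close> show ?thesis by auto
  qed
  have out: "color_of cs' x = color_of cs x" if "x \<notin> set W" for x
    using that vu u(1) unfolding col by (auto simp: transpose_def)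
  have "repair (v # vs) W cs es = repair vs W cs' es" using u(2) by (simp add: cs'_def)
  then show ?case
    using Cons.IH[of cs'] Cons.prems(1,2) bal cb conf keys out by simp
qed

lemma map_fst_round_robin: "map fst (round_robin W c cs k) = rev W @ map fst cs"
  by (induction W arbitrary: c cs) auto

lemma color_of_round_robin: "x \<notin> set W \<Longrightarrow> color_of (round_robin W c cs k) x = color_of cs x"
  by (induction W arbitrary: c cs) auto

text \<open>\<open>c\<close> is the next colour and \<open>q\<close> the number of completed rounds,
  so exactly the colours below \<open>c\<close> are one ahead. Each vertex raises
  \<open>q * k + c\<close> by 1, also when \<open>c\<close> wraps from \<open>k\<close> to
  1.\<close>

lemma round_robin_counts:
  assumes "distinct W" "set W \<inter> A = {}" "finite A" "1 \<le> c" "c \<le> k"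
    and "\<And>x. x \<in> A \<Longrightarrow> 1 \<le> color_of cs x \<and> color_of cs x \<le> k"
    and "\<And>i. i \<in> {1..k} \<Longrightarrow> card {x\<in>A. color_of cs x = i} = (if i < c then q + 1 else q)"
  shows "\<exists>c' q'. 1 \<le> c' \<and> c' \<le> k \<and> q' * k + c' = q * k + c + length W \<and>
    (\<forall>x\<in>A \<union> set W. 1 \<le> color_of (round_robin W c cs k) x \<and> color_of (round_robin W c cs k) x \<le> k) \<and>
    (\<forall>i\<in>{1..k}. card {x\<in>A \<union> set W. color_of (round_robin W c cs k) x = i} =
       (if i < c' then q' + 1 else q'))"
  using assms
proof (induction W arbitrary: A c cs q)
  case Nil
  then show ?case by auto
next
  case (Cons w W)
  define c1 q1 where "c1 = (if c < k then c + 1 else 1)" and "q1 = (if c < k then q else q + 1)"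
  have w: "w \<notin> A" using Cons.prems(2) by auto
  have cnt: "card {x\<in>insert w A. color_of ((w, c) # cs) x = i} = (if i < c1 then q1 + 1 else q1)"
    if i: "i \<in> {1..k}" for i
  proof -
    have "{x\<in>insert w A. color_of ((w, c) # cs) x = i} =
        (if i = c then {w} else {}) \<union> {x\<in>A. color_of cs x = i}"
      using w by auto
    then have "card {x\<in>insert w A. color_of ((w, c) # cs) x = i} =
        (if i = c then 1 else 0) + card {x\<in>A. color_of cs x = i}"
      using w Cons.prems(3) by auto
    then show ?thesis using Cons.prems(7)[OF i] i Cons.prems(4,5) by (auto simp: c1_def q1_def)
  qed
  have "\<exists>c' q'. 1 \<le> c' \<and> c' \<le> k \<and> q' * k + c' = q1 * k + c1 + length W \<and>
    (\<forall>x\<in>insert w A \<union> set W. 1 \<le> color_of (round_robin W c1 ((w, c) # cs) k) x \<and>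
       color_of (round_robin W c1 ((w, c) # cs) k) x \<le> k) \<and>
    (\<forall>i\<in>{1..k}. card {x\<in>insert w A \<union> set W. color_of (round_robin W c1 ((w, c) # cs) k) x = i} =
       (if i < c' then q' + 1 else q'))"
  proof (rule Cons.IH)
    show "1 \<le> color_of ((w, c) # cs) x \<and> color_of ((w, c) # cs) x \<le> k" if "x \<in> insert w A" for x
      using that Cons.prems(4,5) Cons.prems(6)[of x] by auto
  qed (use Cons.prems cnt in \<open>auto simp: c1_def\<close>)
  moreover have "q1 * k + c1 = q * k + c + 1" using Cons.prems(4,5) by (auto simp: c1_def q1_def)
  moreover have "round_robin (w # W) c cs k = round_robin W c1 ((w, c) # cs) k"
    by (simp add: c1_def)
  ultimately show ?case by (simp add: insert_absorb2 del: round_robin.simps)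
qed

lemma round_robin_balanced:
  assumes "distinct W" "0 < k"
  shows "balanced_on k (color_of (round_robin W 1 cs k)) (set W)"
proof -
  from round_robin_counts[of W "{}" 1 k cs 0] assms obtain c q where
    c: "1 \<le> c" "c \<le> k" "q * k + c = 1 + length W" and
    rng: "\<forall>x\<in>set W. 1 \<le> color_of (round_robin W 1 cs k) x \<and> color_of (round_robin W 1 cs k) x \<le> k"
    and cnt: "\<forall>i\<in>{1..k}. card {x\<in>set W. color_of (round_robin W 1 cs k) x = i} =
       (if i < c then q + 1 else q)"
    by auto
  have len: "card (set W) = length W" using assms(1) by (rule distinct_card)
  have W: "length W = q * k + (c - 1)" using c by simp
  have div: "length W div k = q"
    by (rule div_nat_eqI) (use W c(1,2) in \<open>auto simp: algebra_simps\<close>)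
  \<comment> \<open>If \<open>c = 1\<close>, no colour is ahead. Otherwise the remainder
    \<open>c - 1\<close> is positive and forces the ceiling above \<open>q\<close>.\<close>
  have le: "(if i < c then q + 1 else q) \<le> ceil_div (length W) k" if "1 \<le> i" for i
  proof -
    have "k * q + (c - 1) \<le> k * ceil_div (length W) k"
      using ceil_div_bounds(2)[OF assms(2), of "length W"] W by (simp add: mult.commute)
    then have "k * q \<le> k * ceil_div (length W) k" "1 < c \<Longrightarrow> k * q < k * ceil_div (length W) k"
      by linarith+
    then show ?thesis using that assms(2) by auto
  qed
  have empty: "{x\<in>set W. color_of (round_robin W 1 cs k) x = i} = {}" if "i \<notin> {1..k}" for i
    using rng that by auto
  have "card {x\<in>set W. color_of (round_robin W 1 cs k) x = i} \<le> ceil_div (length W) k" for i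
  proof (cases "i \<in> {1..k}")
    case False
    then have "{x\<in>set W. color_of (round_robin W 1 cs k) x = i} = {}" using empty by blast
    then show ?thesis by (simp only: card.empty zero_le)
  qed (use cnt le in auto)
  then show ?thesis
    unfolding balanced_on_def len using rng cnt div by auto
qed

text \<open>The first \<open>ceil_div\<close> bounds a class inside \<open>W\<close> alone. The
  second is added to \<open>N\<close> because the class of the colour of \<open>v\<close> is taken
  among all coloured vertices, and these include \<open>W\<close>.\<close>

fun groups_ok :: "nat \<Rightarrow> nat \<Rightarrow> nat \<Rightarrow> nat list list \<Rightarrow> bool" where
  "groups_ok \<Delta> k N [] \<longleftrightarrow> True"
| "groups_ok \<Delta> k N (W # Ws) \<longleftrightarrow>
     \<Delta> * (ceil_div (length W) k + (N + ceil_div (length W) k)) < length W \<and>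
     groups_ok \<Delta> k (N + ceil_div (length W) k) Ws"

text \<open>Treating a group changes no earlier colour, so balance on a finished group persists. It
  enlarges every class by at most \<open>ceil_div (length W) k\<close>, which is the recursion of
  \<open>groups_ok\<close>.\<close>

lemma color_groups_correct:
  assumes deg: "\<And>x. card (nbrs es x) \<le> \<Delta>" "\<And>x. x \<notin> nbrs es x" and k: "0 < k"
    and "distinct (map fst cs @ concat Ws)" "groups_ok \<Delta> k N Ws" "class_bound N cs" "proper es cs"
  shows "distinct (map fst (color_groups Ws cs es k)) \<and>
    keys (color_groups Ws cs es k) = keys cs \<union> set (concat Ws) \<and>
    (\<forall>x\<in>keys cs. color_of (color_groups Ws cs es k) x = color_of cs x) \<and>
    (\<forall>W\<in>set Ws. balanced_on k (color_of (color_groups Ws cs es k)) (set W)) \<and>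
    proper es (color_groups Ws cs es k)"
  using assms(4-)
proof (induction Ws arbitrary: cs N)
  case Nil
  then show ?case by simp
next
  case (Cons W Ws)
  define N' where "N' = N + ceil_div (length W) k"
  define cs1 where "cs1 = round_robin W 1 cs k"
  define cs2 where "cs2 = repair W W cs1 es"
  have W: "distinct W" "card (set W) = length W" "set W \<inter> keys cs = {}"
    using Cons.prems(1) by (auto simp: distinct_card)
  have fst1: "map fst cs1 = rev W @ map fst cs" by (simp add: cs1_def map_fst_round_robin)
  then have keys1: "keys cs1 = set W \<union> keys cs" by (metis list.set_map set_append set_rev)
  have old: "color_of cs1 x = color_of cs x" if "x \<notin> set W" for x
    using that by (simp add: cs1_def color_of_round_robin)
  have bal1: "balanced_on k (color_of cs1) (set W)"
    unfolding cs1_def by (rule round_robin_balanced[OF W(1) k])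
  have cb1: "class_bound N' cs1"
    unfolding class_bound_def
  proof (intro conjI ballI allI)
    fix x assume "x \<in> keys cs1"
    then show "color_of cs1 x \<noteq> 0"
      using bal1 Cons.prems(3) old[of x] unfolding keys1 balanced_on_def class_bound_def
      by (cases "x \<in> set W") auto
  next
    fix i
    have "{x\<in>keys cs1. color_of cs1 x = i} =
        {x\<in>set W. color_of cs1 x = i} \<union> {x\<in>keys cs. color_of cs x = i}"
      unfolding keys1 using old W(3) by auto
    then have "card {x\<in>keys cs1. color_of cs1 x = i} \<le>
        card {x\<in>set W. color_of cs1 x = i} + card {x\<in>keys cs. color_of cs x = i}"
      by (metis (no_types, lifting) card_Un_le)
    also have "\<dots> \<le> ceil_div (length W) k + N"
      using bal1 Cons.prems(3) W(2) unfolding balanced_on_def class_bound_def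
      by (metis (no_types, lifting) add_mono)
    finally show "card {x\<in>keys cs1. color_of cs1 x = i} \<le> N'" by (simp add: N'_def)
  qed
  have "map fst cs2 = map fst cs1 \<and> (\<forall>x. x \<notin> set W \<longrightarrow> color_of cs2 x = color_of cs1 x) \<and>
      balanced_on k (color_of cs2) (set W) \<and> class_bound N' cs2 \<and> proper es cs2"
    unfolding cs2_def
  proof (rule repair_correct[OF deg _ _ _ bal1 cb1])
    show "\<Delta> * (ceil_div (card (set W)) k + N') < card (set W)"
      using Cons.prems(2) by (simp add: W(2) N'_def)
    \<comment> \<open>The colouring before this group was proper, so a new clash must involve a
      vertex of \<open>W\<close>.\<close>
    show "color_of cs1 a = 0 \<or> a \<in> set W \<or> b \<in> set W"
      if "(a, b) \<in> set es" "color_of cs1 a = color_of cs1 b" for a b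
      using that Cons.prems(4) old unfolding proper_def by fastforce
  qed (auto simp: keys1)
  then have cs2: "map fst cs2 = map fst cs1" "\<And>x. x \<notin> set W \<Longrightarrow> color_of cs2 x = color_of cs x"
      "balanced_on k (color_of cs2) (set W)" "class_bound N' cs2" "proper es cs2"
    using old by auto
  have keys2: "keys cs2 = set W \<union> keys cs" by (metis cs2(1) keys1 list.set_map)
  define out where "out = color_groups Ws cs2 es k"
  have out: "color_groups (W # Ws) cs es k = out" by (simp add: out_def cs2_def cs1_def)
  have IH: "distinct (map fst out) \<and> keys out = keys cs2 \<union> set (concat Ws) \<and>
    (\<forall>x\<in>keys cs2. color_of out x = color_of cs2 x) \<and>
    (\<forall>W\<in>set Ws. balanced_on k (color_of out) (set W)) \<and> proper es out"
    unfolding out_def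
    by (rule Cons.IH[of _ N'])
      (use Cons.prems cs2 in \<open>auto simp: fst1 keys2 N'_def\<close>)
  moreover have "balanced_on k (color_of out) (set W)"
    using IH cs2(3) keys2 balanced_on_cong[of "set W" "color_of out" "color_of cs2" k] by auto
  moreover have "color_of out x = color_of cs x" if "x \<in> keys cs" for x
    using that IH W(3) cs2(2)[of x] keys2 by auto
  ultimately show ?case unfolding out keys2 by auto
qed


section \<open>Grouping the parts\<close>

text \<open>The hypothesis on \<open>k\<close> for each prefix of the parts, with the division by
  the size of its last part cleared; \<open>M\<close> counts the vertices of the earlier
  parts.\<close>

fun parts_ok :: "nat \<Rightarrow> nat \<Rightarrow> nat \<Rightarrow> nat list list \<Rightarrow> bool" where
  "parts_ok \<Delta> k M [] \<longleftrightarrow> True"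
| "parts_ok \<Delta> k M (p # ps) \<longleftrightarrow>
     4 * \<Delta> * (M + length p) \<le> (k - 2 * \<Delta>) * length p \<and> parts_ok \<Delta> k (M + length p) ps"

lemma length_pad: "length (pad W (length W) D k) = max (length W) k"
  by (simp add: pad_def max_def)

lemma group_condition:
  fixes \<Delta> k w M N :: nat
  assumes "0 < \<Delta>" "6 * \<Delta> \<le> k" "k \<le> w"
    and "4 * \<Delta> * M \<le> (k - 2 * \<Delta>) * w" "k * (N + ceil_div w k) \<le> 2 * M + k"
  shows "\<Delta> * (ceil_div w k + (N + ceil_div w k)) < w"
proof -
  define n where "n = ceil_div w k"
  have k: "0 < k" using assms by simp
  have "k * n \<le> 2 * w" using ceil_div_bounds(1)[OF k, of w] assms(3) by (simp add: n_def)
  then have "k * (n + (N + n)) \<le> 2 * M + 3 * w"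
    using assms(3,5) unfolding n_def[symmetric] distrib_left by linarith
  then have "\<Delta> * (k * (n + (N + n))) \<le> \<Delta> * (2 * M + 3 * w)" by (rule mult_le_mono2)
  then have "2 * (k * (\<Delta> * (n + (N + n)))) \<le> 4 * \<Delta> * M + 6 * \<Delta> * w"
    by (simp add: algebra_simps)
  also have "\<dots> \<le> (k - 2 * \<Delta>) * w + 6 * \<Delta> * w" using assms(4) by simp
  also have "\<dots> = (k + 4 * \<Delta>) * w"
    using assms(2) by (simp flip: distrib_right)
  also have "\<dots> < (2 * k) * w" using assms k by (intro mult_strict_right_mono) auto
  finally have "k * (\<Delta> * (n + (N + n))) < k * w" by simp
  then show ?thesis unfolding n_def by simp
qed

text \<open>Two consecutive groups of size at most \<open>k\<close> have more than \<open>k\<close> vertices together, and every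
  group after one with more than \<open>k\<close> vertices is itself that large. Hence the colour classes of a
  prefix with \<open>M\<close> vertices have at most \<open>2 * M / k + 1\<close> vertices; the summand \<open>l\<close> in the invariant
  below makes this inductive. \<open>M\<close> includes the \<open>l\<close> vertices of the open group.\<close>

lemma groups_ok_groups:
  assumes "0 < \<Delta>" "6 * \<Delta> \<le> k" "l = length W"
    and "sorted (map length ps)" "\<And>p. p \<in> set ps \<Longrightarrow> k < l \<Longrightarrow> k < length p"
    and "parts_ok \<Delta> k M ps" "4 * \<Delta> * M \<le> (k - 2 * \<Delta>) * max l k"
    and "l \<le> k \<Longrightarrow> k * (N + 1) + l \<le> 2 * M + k"
    and "k < l \<Longrightarrow> k * (N + ceil_div l k) \<le> 2 * M + k"
  shows "groups_ok \<Delta> k N (groups ps W l D k)"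
  using assms(3-)
proof (induction ps arbitrary: W l D M N)
  case Nil
  have k: "0 < k" using assms by simp
  have "k * (N + ceil_div (max l k) k) \<le> 2 * M + k"
    using Nil.prems(6,7) ceil_div_self[OF k] by (cases "l \<le> k") (auto simp: max_def)
  from group_condition[OF assms(1,2) _ Nil.prems(5) this] show ?case
    using Nil.prems(1) by (simp add: length_pad)
next
  case (Cons p ps)
  have k: "0 < k" using assms by simp
  have acc: "k * (N + ceil_div (max l k) k) \<le> 2 * M + k"
    using Cons.prems(6,7) ceil_div_self[OF k] by (cases "l \<le> k") (auto simp: max_def)
  have p: "4 * \<Delta> * (M + length p) \<le> (k - 2 * \<Delta>) * length p" "parts_ok \<Delta> k (M + length p) ps"
    using Cons.prems(4) by auto
  \<comment> \<open>The condition passes from a part to every larger size, hence to the padded group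
    that contains the part.\<close>
  have mono: "4 * \<Delta> * (M + length p) \<le> (k - 2 * \<Delta>) * x" if "length p \<le> x" for x
    using p(1) mult_le_mono2[OF that, of "k - 2 * \<Delta>"] by linarith
  show ?case
  proof (cases "k < l + length p")
    case True
    define N' where "N' = N + ceil_div (max l k) k"
    have "groups_ok \<Delta> k N' (groups ps p (length p) (D + k) k)"
    proof (rule Cons.IH[where M = "M + length p"])
      show "k < length q" if "q \<in> set ps" "k < length p" for q
        using that Cons.prems(2) by fastforce
      show "k * (N' + 1) + length p \<le> 2 * (M + length p) + k" if "length p \<le> k"
      proof -
        \<comment> \<open>By sortedness no small part follows an open group of more than
          \<open>k\<close> vertices. The closed group thus has exactly \<open>k\<close> vertices
          after padding and adds 1 to each class; \<open>k < l + length p\<close> pays for this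
          \<open>k\<close>.\<close>
        have "l \<le> k" using Cons.prems(3)[of p] that by fastforce
        then have "N' = N + 1" using ceil_div_self[OF k] by (simp add: N'_def max_def)
        then show ?thesis using Cons.prems(6)[OF \<open>l \<le> k\<close>] True by simp
      qed
      show "k * (N' + ceil_div (length p) k) \<le> 2 * (M + length p) + k" if "k < length p"
        using acc ceil_div_bounds(1)[OF k, of "length p"] that
        unfolding N'_def[symmetric] distrib_left by linarith
    qed (use Cons.prems(2) p mono in auto)
    moreover have "\<Delta> * (ceil_div (max l k) k + N') < max l k"
      unfolding N'_def by (rule group_condition[OF assms(1,2) _ Cons.prems(5) acc]) simp
    ultimately show ?thesis using True Cons.prems(1) by (simp add: length_pad N'_def)
  next
    case False
    have "groups_ok \<Delta> k N (groups ps (rev p @ W) (l + length p) D k)"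
    proof (rule Cons.IH[where M = "M + length p"])
      show "k * (N + 1) + (l + length p) \<le> 2 * (M + length p) + k"
        using Cons.prems(6) False by simp
    qed (use Cons.prems(1,2) p mono False in auto)
    then show ?thesis using False by simp
  qed
qed

text \<open>All dummies are at least \<open>D\<close>, so a comparison with \<open>D\<close> can
  remove them at the end.\<close>

lemma set_concat_groups:
  "set (concat (groups ps W l D k)) \<subseteq> set W \<union> set (concat ps) \<union> {D..}"
  "set W \<union> set (concat ps) \<subseteq> set (concat (groups ps W l D k))"
proof (induction ps arbitrary: W l D)
  case (Cons p ps)
  { case 1
    show ?case
    proof (cases "k < l + length p")
      case True
      have pad: "set (pad W l D k) \<subseteq> set W \<union> {D..}" "{D + k..} \<subseteq> {D..}"
        by (auto simp: pad_def)
      have un: "A \<union> B \<subseteq> X \<union> (Y \<union> Z) \<union> S"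
        if "A \<subseteq> X \<union> S" "T \<subseteq> S" "B \<subseteq> Y \<union> Z \<union> T" for A B X Y Z S T :: "nat set"
        using that by blast
      show ?thesis using un[OF pad Cons.IH(1)[of p "length p" "D + k"]] True
        by (simp del: set_concat)
    next
      case False
      then show ?thesis using Cons.IH(1)[of "rev p @ W" "l + length p" D] by auto
    qed }
  { case 2
    show ?case
      using Cons.IH(2)[of p "length p" "D + k"] Cons.IH(2)[of "rev p @ W" "l + length p" D]
      by (auto simp: pad_def) }
qed (auto simp: pad_def)

text \<open>A closed group takes its dummies below \<open>D + k\<close>, and the following groups
  start at \<open>D + k\<close>, however many dummies were used.\<close>

lemma distinct_concat_groups:
  assumes "distinct (W @ concat ps)" "\<And>x. x \<in> set W \<union> set (concat ps) \<Longrightarrow> x < D"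
  shows "distinct (concat (groups ps W l D k))"
  using assms
proof (induction ps arbitrary: W l D)
  case (Cons p ps)
  show ?case
  proof (cases "k < l + length p")
    case True
    have "distinct (concat (groups ps p (length p) (D + k) k))"
      by (rule Cons.IH) (use Cons.prems in \<open>auto simp: trans_less_add1\<close>)
    moreover have "x \<notin> set (concat (groups ps p (length p) (D + k) k))"
      if "x \<in> set (pad W l D k)" for x
    proof
      assume "x \<in> set (concat (groups ps p (length p) (D + k) k))"
      then consider "x \<in> set (concat (p # ps))" | "D + k \<le> x"
        using set_concat_groups(1)[of ps p "length p" "D + k" k] by auto
      then show False
      proof cases
        case 1
        then have "x < D" by (intro Cons.prems(2)) (rule UnI2)
        then show False using 1 that Cons.prems(1) by (auto simp: pad_def)
      next
        case 2
        then have "x \<in> set W" using that by (auto simp: pad_def)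
        then have "x < D" by (intro Cons.prems(2)) (rule UnI1)
        then show False using 2 by simp
      qed
    qed
    moreover have "distinct (pad W l D k)"
      using Cons.prems(1) Cons.prems(2) by (force simp: pad_def)
    ultimately show ?thesis using True by auto
  next
    case False
    have "distinct (concat (groups ps (rev p @ W) (l + length p) D k))"
      by (rule Cons.IH) (use Cons.prems in auto)
    then show ?thesis using False by simp
  qed
qed (force simp: pad_def)

text \<open>The two situations in which balance on the group \<open>W\<close> implies balance on the
  part \<open>p\<close>.\<close>

definition fits :: "nat \<Rightarrow> nat list \<Rightarrow> nat list \<Rightarrow> bool" where
  "fits k p W \<longleftrightarrow> set p \<subseteq> set W \<and> (if length p \<le> k then length W = k else set W = set p)"

text \<open>The open group \<open>W\<close> is treated as one more part. When it absorbs
  \<open>q\<close>, a group that fits the merged list also fits \<open>W\<close> and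
  \<open>q\<close>.\<close>

lemma parts_fit_groups:
  assumes "l = length W" "p \<in> set (W # ps)"
  shows "\<exists>X\<in>set (groups ps W l D k). fits k p X"
  using assms
proof (induction ps arbitrary: W l D p)
  case Nil
  then show ?case by (auto simp: fits_def pad_def)
next
  case (Cons q ps)
  show ?case
  proof (cases "k < l + length q")
    case True
    then show ?thesis
      using Cons.IH[of "length q" q p "D + k"] Cons.prems by (auto simp: fits_def pad_def)
  next
    case False
    show ?thesis
    proof (cases "p \<in> set ps")
      case True
      then show ?thesis
        using Cons.IH[of "l + length q" "rev q @ W" p D] Cons.prems(1) False by auto
    next
      assume "p \<notin> set ps"
      then have "p = q \<or> p = W" using Cons.prems(2) by auto
      moreover obtain X where "X \<in> set (groups ps (rev q @ W) (l + length q) D k)"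
          "fits k (rev q @ W) X"
        using Cons.IH[of "l + length q" "rev q @ W" "rev q @ W" D] Cons.prems(1) by auto
      ultimately show ?thesis
        using False Cons.prems(1) by (auto simp: fits_def intro!: bexI[of _ X])
    qed
  qed
qed

lemma ceil_div_le_1: "0 < k \<Longrightarrow> n \<le> k \<Longrightarrow> ceil_div n k \<le> 1"
  using ceil_div_self[of k] div_le_mono[of "n + k - 1" "k + k - 1" k] by (simp add: ceil_div_def)

text \<open>In a set of at most \<open>k\<close> vertices no colour repeats. A nonempty part with
  fewer than \<open>k\<close> vertices has floor 0 and ceiling 1, so nothing more is required; a
  part with \<open>k\<close> vertices is all of \<open>X\<close> and meets every colour.\<close>

lemma balanced_on_small_part:
  assumes "balanced_on k f X" "finite X" "card X \<le> k" "P \<subseteq> X" "P \<noteq> {}" "i \<in> {1..k}"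
  shows "card {x\<in>P. f x = i} \<in> {card P div k, ceil_div (card P) k}"
proof -
  have k: "0 < k" using assms(6) by auto
  have P: "0 < card P" "card P \<le> k" "finite P"
    using assms card_mono[of X P] finite_subset[of P X] by (auto simp: card_gt_0_iff)
  have "ceil_div (card P) k \<noteq> 0"
  proof
    assume "ceil_div (card P) k = 0"
    then show False using ceil_div_bounds(2)[OF k, of "card P"] P(1) by simp
  qed
  then have 1: "ceil_div (card P) k = 1" using ceil_div_le_1[OF k P(2)] by simp
  have "card {x\<in>X. f x = i} \<le> ceil_div (card X) k" using assms(1) by (simp add: balanced_on_def)
  also have "\<dots> \<le> 1" using ceil_div_le_1[OF k assms(3)] .
  finally have X: "card {x\<in>X. f x = i} \<le> 1" .
  have le: "card {x\<in>P. f x = i} \<le> 1"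
    using card_mono[of "{x\<in>X. f x = i}" "{x\<in>P. f x = i}"] assms(2,4) X by fastforce
  show ?thesis
  proof (cases "card P = k")
    case True
    then have "P = X" using assms card_subset_eq[of X P] card_mono[of X P] by auto
    then have "1 \<le> card {x\<in>P. f x = i}"
      using True assms(1,6) k unfolding balanced_on_def by force
    then show ?thesis using le 1 by simp
  next
    case False
    then have "card P div k = 0" using P by simp
    then show ?thesis using le 1 by auto
  qed
qed

section \<open>Correctness of the whole algorithm\<close>

lemma less_fresh: "x \<in> set xs \<Longrightarrow> x < fresh xs"
  by (induction xs) auto

lemma color_of_filter: "x < D \<Longrightarrow> color_of (filter (\<lambda>(x, c). x < D) cs) x = color_of cs x"
  by (induction cs) auto

lemma solve_correct:
  assumes k: "0 < \<Delta>" "6 * \<Delta> \<le> k" and vs: "distinct vs" "set (concat ps) = set vs"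
    and ps: "distinct (concat ps)" "[] \<notin> set ps" "sorted (map length ps)" "parts_ok \<Delta> k 0 ps"
    and deg: "\<And>x. card (nbrs es x) \<le> \<Delta>" "\<And>x. x \<notin> nbrs es x"
    and es_vs: "set es \<subseteq> set vs \<times> set vs"
  defines "cs \<equiv> solve vs es ps k"
  shows "distinct (map fst cs)" "keys cs = set vs"
    and "x \<in> set vs \<Longrightarrow> 1 \<le> color_of cs x \<and> color_of cs x \<le> k"
    and "(a, b) \<in> set es \<Longrightarrow> color_of cs a \<noteq> color_of cs b"
    and "p \<in> set ps \<Longrightarrow> i \<in> {1..k} \<Longrightarrow>
      card {x\<in>set p. color_of cs x = i} \<in> {length p div k, ceil_div (length p) k}"
proof -
  have k0: "0 < k" using k by simp
  have es: "a \<in> set vs \<and> b \<in> set vs" if "(a, b) \<in> set es" for a b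
    using that es_vs by auto
  have part: "set p \<noteq> {}" "card (set p) = length p" "set p \<subseteq> set vs" if "p \<in> set ps" for p
    using that ps(1,2) vs(2) by (auto simp: distinct_concat_iff distinct_card)
  have "distinct (map fst cs) \<and> keys cs = set vs \<and>
    (\<forall>x\<in>set vs. 1 \<le> color_of cs x \<and> color_of cs x \<le> k) \<and>
    (\<forall>(a, b)\<in>set es. color_of cs a \<noteq> color_of cs b) \<and>
    (\<forall>p\<in>set ps. \<forall>i\<in>{1..k}. card {x\<in>set p. color_of cs x = i} \<in>
       {length p div k, ceil_div (length p) k})"
  proof (cases "k < length vs")
    case False
    then have cs: "cs = round_robin vs 1 [] k" by (simp add: cs_def solve_def)
    have bal: "balanced_on k (color_of cs) (set vs)"
      unfolding cs by (rule round_robin_balanced[OF vs(1) k0])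
    have card: "card (set vs) \<le> k" using False vs(1) by (simp add: distinct_card)
    have fst: "map fst cs = rev vs" by (simp add: cs map_fst_round_robin)
    then have "keys cs = set vs" by (metis list.set_map set_rev)
    moreover have "color_of cs a \<noteq> color_of cs b" if ab: "(a, b) \<in> set es" for a b
    proof
      assume eq: "color_of cs a = color_of cs b"
      have "a \<noteq> b" using ab deg(2)[of a] by (auto simp: nbrs_def)
      have "ceil_div (card (set vs)) k \<le> 1"
        by (rule ceil_div_le_1[OF k0 card])
      then have "card {x\<in>set vs. color_of cs x = color_of cs a} \<le> 1"
        using bal unfolding balanced_on_def by (meson order_trans)
      moreover have "{a, b} \<subseteq> {x\<in>set vs. color_of cs x = color_of cs a}"
        using es[OF ab] eq by auto
      ultimately show False
        using card_mono[of "{x\<in>set vs. color_of cs x = color_of cs a}" "{a, b}"] \<open>a \<noteq> b\<close> by simp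
    qed
    moreover have "card {x\<in>set p. color_of cs x = i} \<in> {length p div k, ceil_div (length p) k}"
      if "p \<in> set ps" "i \<in> {1..k}" for p i
      using balanced_on_small_part[OF bal _ card _ _ that(2), of "set p"] part[OF that(1)] by simp
    ultimately show ?thesis using bal vs(1) unfolding fst balanced_on_def by auto
  next
    case True
    define D where "D = fresh vs"
    define Ws where "Ws = groups ps [] 0 D k"
    define out where "out = color_groups Ws [] es k"
    have cs: "cs = filter (\<lambda>(x, c). x < D) out"
      using True by (simp add: cs_def solve_def D_def Ws_def out_def)
    have D: "x < D" if "x \<in> set vs" for x using that by (simp add: D_def less_fresh)
    have dist: "distinct (concat Ws)"
      unfolding Ws_def by (rule distinct_concat_groups) (use ps vs D in auto)
    have set: "set vs \<subseteq> set (concat Ws)" "set (concat Ws) \<subseteq> set vs \<union> {D..}"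
      using set_concat_groups(1)[of ps "[]" 0 D k] set_concat_groups(2)[of "[]" ps 0 D k] vs(2)
      unfolding Ws_def by auto
    have "groups_ok \<Delta> k 0 Ws"
      unfolding Ws_def by (rule groups_ok_groups[OF k, where M = 0]) (use ps in auto)
    then have "distinct (map fst out) \<and> keys out = set (concat Ws) \<and>
      (\<forall>W\<in>set Ws. balanced_on k (color_of out) (set W)) \<and> proper es out"
      using color_groups_correct[OF deg k0, of "[]" Ws 0] dist
      by (simp add: out_def class_bound_def proper_def)
    then have out: "distinct (map fst out)" "keys out = set (concat Ws)"
      "\<And>W. W \<in> set Ws \<Longrightarrow> balanced_on k (color_of out) (set W)" "proper es out" by auto
    have col: "color_of cs x = color_of out x" if "x \<in> set vs" for x
      using D[OF that] by (simp add: cs color_of_filter)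
    have rng: "1 \<le> color_of cs x \<and> color_of cs x \<le> k" if x: "x \<in> set vs" for x
    proof -
      obtain W where "W \<in> set Ws" "x \<in> set W" using x set(1) by auto
      then show ?thesis using out(3)[of W] x by (auto simp: col balanced_on_def)
    qed
    have "map fst cs = filter (\<lambda>x. x < D) (map fst out)"
      by (simp add: cs filter_map o_def case_prod_unfold)
    then have "distinct (map fst cs)" and keys: "keys cs = {x\<in>keys out. x < D}"
      using out(1) by (simp, metis list.set_map set_filter)
    moreover have "keys cs = set vs"
      unfolding keys out(2) using set D by (fastforce simp del: set_concat)
    \<comment> \<open>\<open>proper\<close> allows equal colours only if they are 0, which
      \<open>rng\<close> excludes on the original vertices.\<close>
    moreover have "color_of cs a \<noteq> color_of cs b" if ab: "(a, b) \<in> set es" for a b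
      using ab es[OF ab] out(4) rng[of a] col unfolding proper_def by fastforce
    moreover have "card {x\<in>set p. color_of cs x = i} \<in> {length p div k, ceil_div (length p) k}"
      if p: "p \<in> set ps" "i \<in> {1..k}" for p i
    proof -
      obtain W where W: "W \<in> set Ws" "fits k p W"
        using parts_fit_groups[of 0 "[]" p ps D k] p(1) unfolding Ws_def by auto
      have "{x\<in>set p. color_of cs x = i} = {x\<in>set p. color_of out x = i}"
        using col part(3)[OF p(1)] by auto
      moreover have "card {x\<in>set p. color_of out x = i} \<in> {length p div k, ceil_div (length p) k}"
      proof (cases "length p \<le> k")
        case True
        then have "set p \<subseteq> set W" "length W = k" using W(2) by (auto simp: fits_def)
        then show ?thesis
          using balanced_on_small_part[OF out(3)[OF W(1)] _ _ _ _ p(2), of "set p"] part[OF p(1)]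
            card_length[of W] by auto
      next
        case False
        then have eq: "set W = set p" using W(2) by (auto simp: fits_def)
        have bal: "balanced_on k (color_of out) (set p)" using out(3)[OF W(1)] eq by simp
        \<comment> \<open>The ceiling exceeds the floor by at most 1, so no third value lies between
          them.\<close>
        have "k * ceil_div (length p) k < k * (length p div k + 2)"
          using ceil_div_bounds(1)[OF k0, of "length p"]
            dividend_less_times_div[OF k0, of "length p"] by (simp add: algebra_simps)
        then have "ceil_div (length p) k < length p div k + 2" by (simp only: mult_less_cancel1)
        moreover have "length p div k \<le> card {x\<in>set p. color_of out x = i}"
            "card {x\<in>set p. color_of out x = i} \<le> ceil_div (length p) k"
          using bal p(2) part(2)[OF p(1)] unfolding balanced_on_def by auto
        ultimately show ?thesis by auto
      qed
      ultimately show ?thesis by simp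
    qed
    ultimately show ?thesis using rng by auto
  qed
  then show "distinct (map fst cs)" "keys cs = set vs"
    "x \<in> set vs \<Longrightarrow> 1 \<le> color_of cs x \<and> color_of cs x \<le> k"
    "(a, b) \<in> set es \<Longrightarrow> color_of cs a \<noteq> color_of cs b"
    "p \<in> set ps \<Longrightarrow> i \<in> {1..k} \<Longrightarrow>
      card {x\<in>set p. color_of cs x = i} \<in> {length p div k, ceil_div (length p) k}"
    by auto
qed

section \<open>Instances\<close>

lemma parts_ok_iff:
  "parts_ok \<Delta> k M ps \<longleftrightarrow> (\<forall>t<length ps.
     4 * \<Delta> * (M + sum_list (map length (take (Suc t) ps))) \<le> (k - 2 * \<Delta>) * length (ps ! t))"
  by (induction ps arbitrary: M) (simp_all add: All_less_Suc2 add.assoc del: mult_Suc_right)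

text \<open>Distinct keys make the first entry found the only one, and \<open>0 < i\<close> rules
  out the default colour.\<close>

lemma mem_assoc_iff:
  "distinct (map fst cs) \<Longrightarrow> 0 < i \<Longrightarrow> (v, i) \<in> set cs \<longleftrightarrow> color_of cs v = i"
proof (induction cs)
  case (Cons p cs)
  then show ?case using color_of_notin[of v cs] by (cases p) force
qed simp

lemma ceiling_div_nat:
  assumes "0 < k"
  shows "\<lceil>real n / real k\<rceil> = int (ceil_div n k)"
proof (rule ceiling_unique)
  have "real k * real (ceil_div n k) < real n + real k"
    using ceil_div_bounds(1)[OF assms, of n] by (metis of_nat_add of_nat_less_iff of_nat_mult)
  then show "of_int (int (ceil_div n k)) - 1 < real n / real k"
    using assms by (simp add: field_simps)
  have "real n \<le> real k * real (ceil_div n k)"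
    using ceil_div_bounds(2)[OF assms, of n] by (metis of_nat_le_iff of_nat_mult)
  then show "real n / real k \<le> of_int (int (ceil_div n k))"
    using assms by (simp add: field_simps)
qed

text \<open>Clears the real quotient in \<open>eta\<close>, using that \<open>Vs t\<close> is
  nonempty; the counting arguments need only this form over the natural numbers.\<close>

lemma admissible_eta:
  assumes "admissible V E \<Delta> d Vs k" "t \<in> {1..d}"
  shows "4 * \<Delta> * (\<Sum>j=1..t. card (Vs j)) + 2 * \<Delta> * card (Vs t) \<le> k * card (Vs t)"
proof -
  define S where "S = (\<Sum>j=1..t. card (Vs j))"
  have adm: "finite V" "Vs t \<noteq> {}" "ordered_partition V d Vs"
      "(4 * eta d Vs + 2) * real \<Delta> \<le> real k"
    using assms unfolding admissible_def finite_graph_def by auto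
  have "Vs t \<subseteq> V" using adm(3) assms(2) by (auto simp: ordered_partition_def)
  then have pos: "0 < real (card (Vs t))"
    using adm(1,2) by (simp add: card_gt_0_iff finite_subset)
  have "real S / real (card (Vs t)) \<le> eta d Vs"
    unfolding eta_def S_def by (rule Max_ge) (use assms(2) in auto)
  then have "(4 * (real S / real (card (Vs t))) + 2) * real \<Delta> \<le> (4 * eta d Vs + 2) * real \<Delta>"
    by (intro mult_right_mono) auto
  also note adm(4)
  finally have "real (4 * \<Delta> * S + 2 * \<Delta> * card (Vs t)) \<le> real (k * card (Vs t))"
    using pos by (simp add: field_simps)
  then show ?thesis unfolding S_def by (rule of_nat_le_iff[THEN iffD1])
qed

lemma degree_le_max_degree:
  assumes "finite_graph V E" "x \<in> V"
  shows "card {e\<in>E. x \<in> e} \<le> max_degree V E"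
  using assms unfolding max_degree_def finite_graph_def vertex_degree_def by (intro Max_ge) auto

text \<open>Serves both claims: the lists come either from an encoded input or from an arbitrary
  enumeration of the instance.\<close>

locale listed_instance =
  fixes V :: "nat set" and E \<Delta> d Vs k vs es ps
  assumes adm: "admissible V E \<Delta> d Vs k"
    and vs: "distinct vs" "set vs = V"
    and es: "{{u, v} | u v. (u, v) \<in> set es} = E"
    and ps: "length ps = d" "\<And>j. j \<in> {1..d} \<Longrightarrow> distinct (ps ! (j - 1)) \<and> set (ps ! (j - 1)) = Vs j"
begin

lemma graph: "finite V" "\<And>e. e \<in> E \<Longrightarrow> e \<subseteq> V \<and> card e = 2"
  and part: "ordered_partition V d Vs"
  and part_nonempty: "\<And>j. j \<in> {1..d} \<Longrightarrow> Vs j \<noteq> {}"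
  and d_pos: "1 \<le> d" and k_pos: "0 < k" and \<Delta>_pos: "0 < \<Delta>"
  using adm unfolding admissible_def finite_graph_def by auto

lemma edge: "(a, b) \<in> set es \<Longrightarrow> {a, b} \<in> E"
  using es by blast

lemma edge_vertices: "(a, b) \<in> set es \<Longrightarrow> a \<in> V \<and> b \<in> V \<and> a \<noteq> b"
  using graph(2)[OF edge[of a b]] by (cases "a = b") auto

lemma edges_subset: "set es \<subseteq> set vs \<times> set vs"
  using edge_vertices vs(2) by auto

lemma ps_nth: "t < d \<Longrightarrow> distinct (ps ! t) \<and> set (ps ! t) = Vs (Suc t)"
  using ps(2)[of "Suc t"] by simp

lemma length_ps_nth: "t < d \<Longrightarrow> length (ps ! t) = card (Vs (Suc t))"
  using ps_nth[of t] distinct_card[of "ps ! t"] by simp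

lemma ps_disjoint: "s < d \<Longrightarrow> t < d \<Longrightarrow> s \<noteq> t \<Longrightarrow> set (ps ! s) \<inter> set (ps ! t) = {}"
  using part ps_nth[of s] ps_nth[of t]
  unfolding ordered_partition_def disjoint_family_on_def by auto

lemma mem_ps: "p \<in> set ps \<longleftrightarrow> (\<exists>t<d. p = ps ! t)"
  using ps(1) by (auto simp: in_set_conv_nth)

lemma nil_notin_ps: "[] \<notin> set ps"
proof
  assume "[] \<in> set ps"
  then obtain t where "t < d" "[] = ps ! t" using mem_ps by auto
  then show False using ps_nth[of t] part_nonempty[of "Suc t"] by auto
qed

lemma distinct_concat_ps: "distinct (concat ps)"
proof (rule distinct_concat)
  show "distinct ps"
    unfolding distinct_conv_nth ps(1)
  proof (intro allI impI notI)
    fix s t assume st: "s < d" "t < d" "s \<noteq> t" "ps ! s = ps ! t"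
    then have "ps ! s = []" using ps_disjoint[of s t] by simp
    then show False using st(1) nil_notin_ps mem_ps by metis
  qed
  show "distinct p" if "p \<in> set ps" for p using that mem_ps ps_nth by auto
  show "set p \<inter> set q = {}" if "p \<in> set ps" "q \<in> set ps" "p \<noteq> q" for p q
    using that ps_disjoint unfolding mem_ps by metis
qed

lemma set_concat_ps: "set (concat ps) = V"
proof -
  have "set (concat ps) = (\<Union>t<d. set (ps ! t))"
    using mem_ps by fastforce
  also have "\<dots> = (\<Union>t<d. Vs (Suc t))" using ps_nth by auto
  also have "\<dots> = (\<Union>j\<in>Suc ` {..<d}. Vs j)" by simp
  also have "Suc ` {..<d} = {1..d}" by (simp add: image_Suc_lessThan)
  finally show ?thesis using part by (simp add: ordered_partition_def)
qed

lemma sorted_ps: "sorted (map length ps)"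
  unfolding sorted_iff_nth_mono
proof (intro allI impI)
  fix i j assume ij: "i \<le> j" "j < length (map length ps)"
  have "\<forall>i\<in>{1..d}. \<forall>j\<in>{1..d}. i \<le> j \<longrightarrow> card (Vs i) \<le> card (Vs j)"
    using adm unfolding admissible_def by auto
  then have "card (Vs (Suc i)) \<le> card (Vs (Suc j))" using ij ps(1) by simp
  then show "map length ps ! i \<le> map length ps ! j" using ij ps(1) by (simp add: length_ps_nth)
qed

text \<open>For \<open>t = 1\<close> the quotient in \<open>eta\<close> is 1, and
  \<open>4 * 1 + 2 = 6\<close>.\<close>

lemma six_\<Delta>_le: "6 * \<Delta> \<le> k"
proof -
  have "4 * \<Delta> * card (Vs 1) + 2 * \<Delta> * card (Vs 1) \<le> k * card (Vs 1)"
    using admissible_eta[OF adm, of 1] d_pos by simp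
  then have "(6 * \<Delta>) * card (Vs 1) \<le> k * card (Vs 1)" by simp
  moreover have "card (Vs 1) \<noteq> 0"
  proof
    assume "card (Vs 1) = 0"
    then have "ps ! 0 = []" using length_ps_nth[of 0] d_pos by simp
    moreover have "ps ! 0 \<in> set ps" using ps(1) d_pos by simp
    ultimately show False using nil_notin_ps by simp
  qed
  ultimately show ?thesis by simp
qed

lemma parts_ok_ps: "parts_ok \<Delta> k 0 ps"
  unfolding parts_ok_iff
proof (intro allI impI)
  fix t assume "t < length ps"
  then have t: "t < d" using ps(1) by simp
  have "sum_list (map length (take (Suc t) ps)) = (\<Sum>i<Suc t. length (ps ! i))"
    using t ps(1) by (simp add: sum_list_sum_nth atLeast0LessThan)
  also have "\<dots> = (\<Sum>i<Suc t. card (Vs (Suc i)))"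
    using t by (intro sum.cong) (auto simp: length_ps_nth)
  also have "\<dots> = (\<Sum>j=1..Suc t. card (Vs j))" by (simp add: sum.atLeast1_atMost_eq del: sum.lessThan_Suc sum.cl_ivl_Suc)
  finally have "4 * \<Delta> * sum_list (map length (take (Suc t) ps)) + 2 * \<Delta> * length (ps ! t)
      \<le> k * length (ps ! t)"
    using admissible_eta[OF adm, of "Suc t"] t by (simp add: length_ps_nth)
  then show "4 * \<Delta> * (0 + sum_list (map length (take (Suc t) ps))) \<le> (k - 2 * \<Delta>) * length (ps ! t)"
    by (simp add: diff_mult_distrib)
qed

lemma nbrs_irrefl: "x \<notin> nbrs es x"
  using edge_vertices by (auto simp: nbrs_def)

text \<open>Neighbours form a set, so repeated or reversed entries of the edge list do no harm, and
  \<open>y \<mapsto> {x, y}\<close> injects them into the edges at \<open>x\<close>. Dummies lie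
  outside \<open>V\<close> and have no neighbours.\<close>

lemma card_nbrs_le: "card (nbrs es x) \<le> \<Delta>"
proof (cases "x \<in> V")
  case True
  have "E \<subseteq> Pow V" using graph(2) by auto
  then have "finite {e\<in>E. x \<in> e}" using graph(1) by (auto intro: finite_subset)
  moreover have "(\<lambda>y. {x, y}) ` nbrs es x \<subseteq> {e\<in>E. x \<in> e}"
    using edge by (fastforce simp: nbrs_def insert_commute)
  moreover have "inj_on (\<lambda>y. {x, y}) (nbrs es x)"
    by (auto simp: inj_on_def doubleton_eq_iff)
  ultimately have "card (nbrs es x) \<le> card {e\<in>E. x \<in> e}" by (metis card_inj_on_le)
  also have "\<dots> \<le> max_degree V E"
    using adm True by (intro degree_le_max_degree) (auto simp: admissible_def)
  finally show ?thesis using adm by (simp add: admissible_def)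
next
  case False
  then have "nbrs es x = {}" using edge_vertices by (auto simp: nbrs_def)
  then show ?thesis by simp
qed

definition "sol = solve vs es ps k"
definition "C i = {v. (v, i) \<in> set sol}"

lemmas sol_correct = solve_correct[OF \<Delta>_pos six_\<Delta>_le vs(1) set_concat_ps[folded vs(2)]
  distinct_concat_ps nil_notin_ps sorted_ps parts_ok_ps card_nbrs_le nbrs_irrefl
  edges_subset, folded sol_def]

lemma in_C_iff: "i \<in> {1..k} \<Longrightarrow> v \<in> C i \<longleftrightarrow> color_of sol v = i"
  using mem_assoc_iff[OF sol_correct(1), of i v] by (simp add: C_def)

lemma C_coloring: "k_coloring V E k C"
proof -
  have "C i \<subseteq> V" for i using sol_correct(2) vs(2) by (force simp: C_def)
  moreover have "\<exists>i\<in>{1..k}. v \<in> C i" if "v \<in> V" for v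
    using sol_correct(3)[of v] that vs(2) in_C_iff[of "color_of sol v" v] by auto
  moreover have "C i \<inter> C j = {}" if "i \<in> {1..k}" "j \<in> {1..k}" "i \<noteq> j" for i j
    using that in_C_iff by auto
  moreover have "\<not> e \<subseteq> C i" if e: "e \<in> E" and i: "i \<in> {1..k}" for e i
  proof
    assume sub: "e \<subseteq> C i"
    obtain a b where "e = {a, b}" "(a, b) \<in> set es" using e es by blast
    then show False using sub sol_correct(4)[of a b] in_C_iff[OF i] by auto
  qed
  ultimately show ?thesis
    unfolding k_coloring_def ordered_partition_def disjoint_family_on_def independent_set_def
    by (intro conjI ballI) (fastforce | auto)+
qed

lemma C_balanced: "balanced d Vs k C"
  unfolding balanced_def
proof (intro ballI)
  fix i j assume i: "i \<in> {1..k}" and j: "j \<in> {1..d}"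
  define p where "p = ps ! (j - 1)"
  have p: "p \<in> set ps" "set p = Vs j" "length p = card (Vs j)"
    using j ps(1) ps(2)[OF j] length_ps_nth[of "j - 1"] by (auto simp: p_def)
  have "C i \<inter> Vs j = {x\<in>set p. color_of sol x = i}"
    using in_C_iff[OF i] p(2) by auto
  then have "card (C i \<inter> Vs j) \<in> {card (Vs j) div k, ceil_div (card (Vs j)) k}"
    using sol_correct(5)[OF p(1) i] p(3) by simp
  then show "int (card (C i \<inter> Vs j)) \<in>
      {\<lfloor>real (card (Vs j)) / real k\<rfloor>, \<lceil>real (card (Vs j)) / real k\<rceil>}"
    unfolding ceiling_div_nat[OF k_pos] floor_divide_of_nat_eq by auto
qed

end

section \<open>The polynomial bound in the input size, and existence for arbitrary vertex
  types\<close>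

lemma length_le_vsize: "length xs \<le> vsize (enc_list f xs)"
  by (induction xs) auto

lemma length_concat_le_vsize: "length (concat xss) \<le> vsize (enc_list (enc_list f) xss)"
proof (induction xss)
  case (Cons xs xss)
  then show ?case using length_le_vsize[of xs f] by simp
qed simp

lemma prog_polynomial_time:
  assumes "admissible V E \<Delta> d Vs k" "encodes_instance x V E d Vs k"
  shows "\<exists>y t C. runs prog x y t \<and> t \<le> poly (monom 1000002 8) (vsize x) \<and>
    encodes_coloring y V k C \<and> k_coloring V E k C \<and> balanced d Vs k C"
proof -
  obtain vs es ps where l: "distinct vs" "set vs = V" "{{u, v} | u v. (u, v) \<in> set es} = E"
      "length ps = d" "\<forall>j\<in>{1..d}. distinct (ps ! (j - 1)) \<and> set (ps ! (j - 1)) = Vs j"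
    and x: "x = VPair (enc_nats vs) (VPair (enc_assoc es) (VPair (enc_list enc_nats ps) (VNum k)))"
    using assms(2) unfolding encodes_instance_def by blast
  interpret listed_instance V E \<Delta> d Vs k vs es ps
    by unfold_locales (use assms(1) l in auto)
  have S: "1 \<le> vsize x" by (cases x) auto
  have "evb prog [x] (prog ! 0) (enc_assoc sol) (1000000 * vsize x ^ 8)"
    unfolding x sol_def
    by (rule evb_solve)
      (use length_le_vsize[of vs VNum] length_le_vsize[of es enc_nat_pair]
         length_le_vsize[of ps enc_nats] length_concat_le_vsize[of ps VNum] in auto)
  then have "evb prog [x] (Call 0 (Var 0)) (enc_assoc sol) (1 + 1000000 * vsize x ^ 8 + 1)"
    by (rule evb_Call[OF evb_Var0 length_prog(1)])
  then obtain t where t: "runs prog x (enc_assoc sol) t" "t \<le> 1 + 1000000 * vsize x ^ 8 + 1"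
    by (auto simp: evb_def runs_def)
  \<comment> \<open>This absorbs the two extra steps of the outermost call into the coefficient
    1000002.\<close>
  have "1 \<le> vsize x ^ 8" using S by (rule one_le_power)
  then have "t \<le> poly (monom 1000002 8) (vsize x)"
    using t(2) by (simp add: poly_monom)
  moreover have "encodes_coloring (enc_assoc sol) V k C"
    unfolding encodes_coloring_def using sol_correct(1,2) vs(2)
    by (intro exI[of _ sol]) (auto simp: C_def)
  ultimately show ?thesis using t(1) C_coloring C_balanced by blast
qed

text \<open>Existence is read off from the correctness of the algorithm, since every finite instance
  can be listed.\<close>

lemma ex_balanced_coloring_nat:
  fixes V :: "nat set"
  assumes "admissible V E \<Delta> d Vs k"
  shows "\<exists>C. k_coloring V E k C \<and> balanced d Vs k C"
proof -
  have fin: "finite V" and E: "\<And>e. e \<in> E \<Longrightarrow> e \<subseteq> V \<and> card e = 2"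
    and Vs: "\<And>j. j \<in> {1..d} \<Longrightarrow> Vs j \<subseteq> V"
    using assms unfolding admissible_def finite_graph_def ordered_partition_def by auto
  have "finite {(u, v). {u, v} \<in> E}"
    by (rule finite_subset[of _ "V \<times> V"]) (use fin E in auto)
  \<comment> \<open>Each edge is listed in both orientations, which avoids choosing one.\<close>
  then obtain es where es: "set es = {(u, v). {u, v} \<in> E}" using finite_list by blast
  have "{{u, v} | u v. (u, v) \<in> set es} = E"
    using E unfolding es by (auto simp: card_2_iff) (metis E card_2_iff)
  then have "listed_instance V E \<Delta> d Vs k (sorted_list_of_set V) es
      (map (\<lambda>j. sorted_list_of_set (Vs (Suc j))) [0..<d])"
    using assms fin finite_subset[OF Vs fin] by unfold_locales auto
  then show ?thesis
    using listed_instance.C_coloring listed_instance.C_balanced by blast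
qed

text \<open>Admissibility depends only on cardinalities and incidences, so an injection of
  \<open>V\<close> into the natural numbers carries the instance over. The colouring found there is
  pulled back along it.\<close>

lemma ex_balanced_coloring:
  fixes V :: "'a set"
  assumes adm: "admissible V E \<Delta> d Vs k"
  shows "\<exists>C. k_coloring V E k C \<and> balanced d Vs k C"
proof -
  have fin: "finite V" and E: "\<And>e. e \<in> E \<Longrightarrow> e \<subseteq> V \<and> card e = 2"
    and part: "(\<Union>j\<in>{1..d}. Vs j) = V" "disjoint_family_on Vs {1..d}"
    and Vs: "\<And>j. j \<in> {1..d} \<Longrightarrow> Vs j \<subseteq> V"
    using adm unfolding admissible_def finite_graph_def ordered_partition_def by auto
  obtain f :: "'a \<Rightarrow> nat" where inj: "inj_on f V"
    using finite_imp_inj_to_nat_seg[OF fin] by blast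
  have card: "card (f ` X) = card X" if "X \<subseteq> V" for X
    using inj that by (meson card_image inj_on_subset)
  have mem: "f v \<in> f ` X \<longleftrightarrow> v \<in> X" if "X \<subseteq> V" "v \<in> V" for v X
    using inj_on_image_mem_iff[OF inj that(2,1)] .
  have deg: "vertex_degree ((`) f ` E) (f v) = vertex_degree E v" if v: "v \<in> V" for v
  proof -
    have "{e \<in> (`) f ` E. f v \<in> e} = (`) f ` {e\<in>E. f v \<in> f ` e}" by auto
    also have "{e\<in>E. f v \<in> f ` e} = {e\<in>E. v \<in> e}"
      using mem[OF _ v] E by (intro Collect_cong) blast
    finally have "{e \<in> (`) f ` E. f v \<in> e} = (`) f ` {e\<in>E. v \<in> e}" .
    moreover have "inj_on ((`) f) {e\<in>E. v \<in> e}"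
      using inj E by (intro inj_onI) (metis (no_types, lifting) inj_on_image_eq_iff mem_Collect_eq)
    ultimately show ?thesis unfolding vertex_degree_def by (simp add: card_image)
  qed
  have maxdeg: "max_degree (f ` V) ((`) f ` E) = max_degree V E"
    unfolding max_degree_def image_image using deg by (metis (no_types, lifting) image_cong)
  have sums: "(\<Sum>j=1..t. card (f ` Vs j)) = (\<Sum>j=1..t. card (Vs j))" if "t \<in> {1..d}" for t
    using that by (intro sum.cong refl card Vs) auto
  have "eta d (\<lambda>j. f ` Vs j) = eta d Vs"
    unfolding eta_def
    by (intro arg_cong[of _ _ Max] image_cong refl) (simp add: sums card Vs)
  moreover have "disjoint_family_on (\<lambda>j. f ` Vs j) {1..d}"
    unfolding disjoint_family_on_def
  proof (intro ballI impI)
    fix i j assume ij: "i \<in> {1..d}" "j \<in> {1..d}" "i \<noteq> j"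
    then have "Vs i \<inter> Vs j = {}" using part(2) by (auto simp: disjoint_family_on_def)
    then show "f ` Vs i \<inter> f ` Vs j = {}"
      using inj_on_image_Int[OF inj Vs[OF ij(1)] Vs[OF ij(2)]] by simp
  qed
  moreover have "finite_graph (f ` V) ((`) f ` E)"
    unfolding finite_graph_def using fin E card by fastforce
  moreover have "(\<Union>j\<in>{1..d}. f ` Vs j) = f ` V"
    by (simp only: part(1)[symmetric] image_UN)
  ultimately have "admissible (f ` V) ((`) f ` E) \<Delta> d (\<lambda>j. f ` Vs j) k"
    using adm unfolding admissible_def ordered_partition_def by (simp add: maxdeg card Vs)
  then obtain C' where C': "k_coloring (f ` V) ((`) f ` E) k C'" "balanced d (\<lambda>j. f ` Vs j) k C'"
    using ex_balanced_coloring_nat by blast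
  define C where "C i = {v\<in>V. f v \<in> C' i}" for i
  have "k_coloring V E k C"
    unfolding k_coloring_def ordered_partition_def
  proof (intro conjI ballI)
    show "(\<Union>i\<in>{1..k}. C i) = V"
      using C'(1) unfolding k_coloring_def ordered_partition_def C_def by blast
    show "disjoint_family_on C {1..k}"
      using C'(1) unfolding k_coloring_def ordered_partition_def C_def disjoint_family_on_def
      by blast
    show "independent_set V E (C i)" if "i \<in> {1..k}" for i
    proof -
      have "\<not> f ` e \<subseteq> C' i" if "e \<in> E" for e
        using C'(1) \<open>i \<in> {1..k}\<close> that unfolding k_coloring_def independent_set_def by blast
      then show ?thesis unfolding independent_set_def C_def by blast
    qed
  qed
  moreover have "card (C i \<inter> Vs j) = card (C' i \<inter> f ` Vs j)" if "j \<in> {1..d}" for i j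
  proof -
    have "f ` (C i \<inter> Vs j) = C' i \<inter> f ` Vs j" using Vs[OF that] by (auto simp: C_def)
    moreover have "C i \<inter> Vs j \<subseteq> V" using Vs[OF that] by blast
    ultimately show ?thesis using card[of "C i \<inter> Vs j"] by simp
  qed
  then have "balanced d Vs k C"
    using C'(2) unfolding balanced_def by (simp add: card Vs)
  ultimately show ?thesis by blast
qed

theorem theorem8:
  "(\<forall>(V :: 'a set) E \<Delta> d Vs k.
      admissible V E \<Delta> d Vs k \<longrightarrow>
      (\<exists>C. k_coloring V E k C \<and> balanced d Vs k C))
   \<and>
   (\<exists>P. \<exists>p :: nat poly. \<forall>x V E \<Delta> d Vs k.
      admissible V E \<Delta> d Vs k \<and> encodes_instance x V E d Vs k \<longrightarrow>
      (\<exists>y t C. runs P x y t \<and> t \<le> poly p (vsize x) \<and>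
         encodes_coloring y V k C \<and> k_coloring V E k C \<and> balanced d Vs k C))"
  using ex_balanced_coloring prog_polynomial_time by blast

end
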